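(* There is a (dynamic programming) algorithm that, given a positive integer $n$, a probability vector $\boldsymbol{p}=(p_1,\dots,p_n)$ with $p_1\ge p_2\ge\dots\ge p_n>0$, and a set $\Lambda$ of positive integers, listed in increasing order, that contains an element $\ge\log_2 n$, outputs an optimal reserved-length binary prefix code for $(\boldsymbol{p},\Lambda)$, i.e. a binary prefix code for $n$ symbols all of whose codeword lengths $l_1,\dots,l_n$ lie in $\Lambda$ and which minimizes $\sum_{i=1}^n p_i l_i$ among all such codes. If $\Lambda$ is finite, the algorithm runs in $O(|\Lambda|n^3)$ time and $O(|\Lambda|n^2)$ space. For every such $\Lambda$ (finite or infinite) it runs in $O(n^4)$ time and $O(n^3)$ space.
   Context: A binary prefix code for $n$ symbols assigns to each symbol $i\in\{1,\dots,n\}$ a binary codeword $c_i$ of length $l_i\in\mathbb{Z}_+$ (positive integers) so that no codeword is a prefix of another. A prefix code with lengths $l_1,\dots,l_n$ exists if and only if the Kraft inequality $\sum_{i=1}^n 2^{-l_i}\le 1$ holds. The problem of minimizing $\sum_i p_i l_i$ subject to the Kraft inequality and $l_i\in\Lambda$ for all $i$ is the reserved-length prefix coding problem. Computational model: arithmetic operations (additions, comparisons and multiplications of real numbers, and additions, comparisons and bit shifts of integers) take constant time, and each stored number takes unit space. When $\Lambda$ is infinite, its elements are read one by one in increasing order, each in constant time. *)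

theory Defs
  imports "HOL-Analysis.Analysis" "HOL-Library.Sublist" "HOL-Library.Infinite_Set"
begin

section \<open>Reserved-length prefix codes\<close>

text \<open>A code for \<open>n\<close> symbols is a function on the indices \<open>{1..n}\<close>; its values elsewhere are
  irrelevant.\<close>

definition prefix_code :: "nat \<Rightarrow> (nat \<Rightarrow> bool list) \<Rightarrow> bool" where
  "prefix_code n c \<longleftrightarrow>
     (\<forall>i\<in>{1..n}. length (c i) > 0) \<and>
     (\<forall>i\<in>{1..n}. \<forall>j\<in>{1..n}. i \<noteq> j \<longrightarrow> \<not> prefix (c i) (c j))"

definition reserved_length_code :: "nat \<Rightarrow> nat set \<Rightarrow> (nat \<Rightarrow> bool list) \<Rightarrow> bool" where
  "reserved_length_code n \<Lambda> c \<longleftrightarrow> prefix_code n c \<and> (\<forall>i\<in>{1..n}. length (c i) \<in> \<Lambda>)"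

definition code_cost :: "nat \<Rightarrow> (nat \<Rightarrow> real) \<Rightarrow> (nat \<Rightarrow> bool list) \<Rightarrow> real" where
  "code_cost n p c = (\<Sum>i=1..n. p i * real (length (c i)))"

definition optimal_reserved_length_code ::
  "nat \<Rightarrow> (nat \<Rightarrow> real) \<Rightarrow> nat set \<Rightarrow> (nat \<Rightarrow> bool list) \<Rightarrow> bool" where
  "optimal_reserved_length_code n p \<Lambda> c \<longleftrightarrow>
     reserved_length_code n \<Lambda> c \<and>
     (\<forall>c'. reserved_length_code n \<Lambda> c' \<longrightarrow> code_cost n p c \<le> code_cost n p c')"

definition valid_instance :: "nat \<Rightarrow> (nat \<Rightarrow> real) \<Rightarrow> nat set \<Rightarrow> bool" where
  "valid_instance n p \<Lambda> \<longleftrightarrow>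
     n \<ge> 1 \<and>
     (\<forall>i j. 1 \<le> i \<longrightarrow> i \<le> j \<longrightarrow> j \<le> n \<longrightarrow> p j \<le> p i) \<and>
     (\<forall>i\<in>{1..n}. p i > 0) \<and>
     (\<Sum>i=1..n. p i) = 1 \<and>
     (\<forall>l\<in>\<Lambda>. l > 0) \<and>
     (\<exists>l\<in>\<Lambda>. real l \<ge> log 2 (real n))"

section \<open>The computational model\<close>

text \<open>Structured programs for a random access machine with integer and real registers and with
  integer and real arrays, all addressed by numbers that are fixed in the program text (hence
  finitely many for each program). The unit-cost operations are additions,
  comparisons and bit shifts of integers, additions, comparisons and multiplications of reals, data
  movement, and reading the next element of \<open>\<Lambda>\<close>. An integer can be used as a real number, but no
  instruction turns a real into an integer, and the only constants are integers, so that a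
  program cannot carry infinite information in a real constant.\<close>

datatype instr =
    IConst nat int
  | ICopy nat nat
  | IAdd nat nat nat
  | IShl nat nat nat
  | IShr nat nat nat
  | ILoad nat nat nat     \<comment> \<open>\<open>ILoad r A k\<close>: register \<open>r\<close> gets the cell of array \<open>A\<close> at the index in register \<open>k\<close>\<close>
  | IStore nat nat nat    \<comment> \<open>\<open>IStore A k r\<close>: the cell of array \<open>A\<close> at the index in register \<open>k\<close> gets register \<open>r\<close>\<close>
  | ReadNext nat
  | RConst nat int
  | RCopy nat nat
  | ROfInt nat nat        \<comment> \<open>\<open>ROfInt x r\<close>: real register \<open>x\<close> gets the integer in register \<open>r\<close>\<close>
  | RAdd nat nat nat
  | RMul nat nat nat
  | RLoad nat nat nat
  | RStore nat nat nat

datatype test =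
    ILess nat nat
  | ILeq nat nat
  | RLess nat nat
  | RLeq nat nat

datatype com =
    Basic instr
  | Seq com com
  | Cond test com com
  | While test com

record state =
  ireg :: "nat \<Rightarrow> int"
  rreg :: "nat \<Rightarrow> real"
  iarr :: "nat \<Rightarrow> nat \<Rightarrow> int"
  rarr :: "nat \<Rightarrow> nat \<Rightarrow> real"
  rpos :: nat             \<comment> \<open>how many elements of \<open>\<Lambda>\<close> have been read\<close>

text \<open>The elements of \<open>\<Lambda>\<close> in increasing order; \<open>0\<close>, which is never an element of \<open>\<Lambda>\<close>,
  signals that a finite \<open>\<Lambda>\<close> is exhausted.\<close>

definition input_elem :: "nat set \<Rightarrow> nat \<Rightarrow> nat" where
  "input_elem \<Lambda> j = (if finite \<Lambda> \<and> card \<Lambda> \<le> j then 0 else enumerate \<Lambda> j)"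

text \<open>Instructions with a negative array index or a negative shift amount are not executable: the
  machine gets stuck.\<close>

fun enabled :: "instr \<Rightarrow> state \<Rightarrow> bool" where
  "enabled (IShl r a b) s = (ireg s b \<ge> 0)"
| "enabled (IShr r a b) s = (ireg s b \<ge> 0)"
| "enabled (ILoad r A k) s = (ireg s k \<ge> 0)"
| "enabled (IStore A k r) s = (ireg s k \<ge> 0)"
| "enabled (RLoad x A k) s = (ireg s k \<ge> 0)"
| "enabled (RStore A k x) s = (ireg s k \<ge> 0)"
| "enabled _ s = True"

fun step :: "nat set \<Rightarrow> instr \<Rightarrow> state \<Rightarrow> state" where
  "step \<Lambda> (IConst r v) s = s\<lparr>ireg := (ireg s)(r := v)\<rparr>"
| "step \<Lambda> (ICopy r a) s = s\<lparr>ireg := (ireg s)(r := ireg s a)\<rparr>"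
| "step \<Lambda> (IAdd r a b) s = s\<lparr>ireg := (ireg s)(r := ireg s a + ireg s b)\<rparr>"
| "step \<Lambda> (IShl r a b) s = s\<lparr>ireg := (ireg s)(r := push_bit (nat (ireg s b)) (ireg s a))\<rparr>"
| "step \<Lambda> (IShr r a b) s = s\<lparr>ireg := (ireg s)(r := drop_bit (nat (ireg s b)) (ireg s a))\<rparr>"
| "step \<Lambda> (ILoad r A k) s = s\<lparr>ireg := (ireg s)(r := iarr s A (nat (ireg s k)))\<rparr>"
| "step \<Lambda> (IStore A k r) s =
     s\<lparr>iarr := (iarr s)(A := (iarr s A)(nat (ireg s k) := ireg s r))\<rparr>"
| "step \<Lambda> (ReadNext r) s =
     s\<lparr>ireg := (ireg s)(r := int (input_elem \<Lambda> (rpos s))), rpos := Suc (rpos s)\<rparr>"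
| "step \<Lambda> (RConst x v) s = s\<lparr>rreg := (rreg s)(x := of_int v)\<rparr>"
| "step \<Lambda> (RCopy x y) s = s\<lparr>rreg := (rreg s)(x := rreg s y)\<rparr>"
| "step \<Lambda> (ROfInt x r) s = s\<lparr>rreg := (rreg s)(x := of_int (ireg s r))\<rparr>"
| "step \<Lambda> (RAdd x y z) s = s\<lparr>rreg := (rreg s)(x := rreg s y + rreg s z)\<rparr>"
| "step \<Lambda> (RMul x y z) s = s\<lparr>rreg := (rreg s)(x := rreg s y * rreg s z)\<rparr>"
| "step \<Lambda> (RLoad x A k) s = s\<lparr>rreg := (rreg s)(x := rarr s A (nat (ireg s k)))\<rparr>"
| "step \<Lambda> (RStore A k x) s =
     s\<lparr>rarr := (rarr s)(A := (rarr s A)(nat (ireg s k) := rreg s x))\<rparr>"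

fun holds :: "test \<Rightarrow> state \<Rightarrow> bool" where
  "holds (ILess a b) s = (ireg s a < ireg s b)"
| "holds (ILeq a b) s = (ireg s a \<le> ireg s b)"
| "holds (RLess x y) s = (rreg s x < rreg s y)"
| "holds (RLeq x y) s = (rreg s x \<le> rreg s y)"

text \<open>Storage cells, each holding one number. To measure space we record the cells that an
  execution touches.\<close>

datatype cell = IReg nat | RReg nat | ICell nat nat | RCell nat nat

fun instr_cells :: "instr \<Rightarrow> state \<Rightarrow> cell set" where
  "instr_cells (IConst r v) s = {IReg r}"
| "instr_cells (ICopy r a) s = {IReg r, IReg a}"
| "instr_cells (IAdd r a b) s = {IReg r, IReg a, IReg b}"
| "instr_cells (IShl r a b) s = {IReg r, IReg a, IReg b}"
| "instr_cells (IShr r a b) s = {IReg r, IReg a, IReg b}"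
| "instr_cells (ILoad r A k) s = {IReg r, IReg k, ICell A (nat (ireg s k))}"
| "instr_cells (IStore A k r) s = {IReg r, IReg k, ICell A (nat (ireg s k))}"
| "instr_cells (ReadNext r) s = {IReg r}"
| "instr_cells (RConst x v) s = {RReg x}"
| "instr_cells (RCopy x y) s = {RReg x, RReg y}"
| "instr_cells (ROfInt x r) s = {RReg x, IReg r}"
| "instr_cells (RAdd x y z) s = {RReg x, RReg y, RReg z}"
| "instr_cells (RMul x y z) s = {RReg x, RReg y, RReg z}"
| "instr_cells (RLoad x A k) s = {RReg x, IReg k, RCell A (nat (ireg s k))}"
| "instr_cells (RStore A k x) s = {RReg x, IReg k, RCell A (nat (ireg s k))}"

fun test_cells :: "test \<Rightarrow> cell set" where
  "test_cells (ILess a b) = {IReg a, IReg b}"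
| "test_cells (ILeq a b) = {IReg a, IReg b}"
| "test_cells (RLess x y) = {RReg x, RReg y}"
| "test_cells (RLeq x y) = {RReg x, RReg y}"

text \<open>\<open>exec \<Lambda> P s t U s'\<close>: started in state \<open>s\<close>, the program \<open>P\<close> halts in state \<open>s'\<close> after
  \<open>t\<close> unit-cost operations, having touched exactly the cells in \<open>U\<close>.\<close>

inductive exec :: "nat set \<Rightarrow> com \<Rightarrow> state \<Rightarrow> nat \<Rightarrow> cell set \<Rightarrow> state \<Rightarrow> bool"
  for \<Lambda> :: "nat set" where
  exec_Basic: "enabled i s \<Longrightarrow> exec \<Lambda> (Basic i) s 1 (instr_cells i s) (step \<Lambda> i s)"
| exec_Seq: "exec \<Lambda> P s t U s' \<Longrightarrow> exec \<Lambda> Q s' t' U' s'' \<Longrightarrow>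
     exec \<Lambda> (Seq P Q) s (t + t') (U \<union> U') s''"
| exec_CondT: "holds b s \<Longrightarrow> exec \<Lambda> P s t U s' \<Longrightarrow>
     exec \<Lambda> (Cond b P Q) s (1 + t) (test_cells b \<union> U) s'"
| exec_CondF: "\<not> holds b s \<Longrightarrow> exec \<Lambda> Q s t U s' \<Longrightarrow>
     exec \<Lambda> (Cond b P Q) s (1 + t) (test_cells b \<union> U) s'"
| exec_WhileF: "\<not> holds b s \<Longrightarrow> exec \<Lambda> (While b P) s 1 (test_cells b) s"
| exec_WhileT: "holds b s \<Longrightarrow> exec \<Lambda> P s t U s' \<Longrightarrow> exec \<Lambda> (While b P) s' t' U' s'' \<Longrightarrow>
     exec \<Lambda> (While b P) s (1 + t + t') (test_cells b \<union> U \<union> U') s''"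

lemma exec_deterministic:
  assumes "exec \<Lambda> P s t U s'" and "exec \<Lambda> P s t2 U2 s2"
  shows "t = t2 \<and> U = U2 \<and> s' = s2"
  using assms
proof (induction arbitrary: t2 U2 s2 rule: exec.induct)
  case (exec_Basic i s)
  then show ?case by (auto elim: exec.cases)
next
  case (exec_Seq P s t U s' Q t' U' s'')
  from exec_Seq.prems show ?case
    by cases (use exec_Seq.IH in blast)
next
  case (exec_CondT b s P t U s' Q)
  from exec_CondT.prems show ?case
    by cases (use exec_CondT.IH exec_CondT.hyps in blast)+
next
  case (exec_CondF b s Q t U s' P)
  from exec_CondF.prems show ?case
    by cases (use exec_CondF.IH exec_CondF.hyps in blast)+
next
  case (exec_WhileF b s P)
  from exec_WhileF.prems show ?case
    by cases (use exec_WhileF.hyps in blast)+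
next
  case (exec_WhileT b s P t U s' t' U' s'')
  from exec_WhileT.prems show ?case
    by cases (use exec_WhileT.IH exec_WhileT.hyps in blast)+
qed

lemma finite_touched_cells:
  assumes "exec \<Lambda> P s t U s'"
  shows "finite U"
proof -
  have i: "finite (instr_cells i s)" for i s by (cases i) auto
  have b: "finite (test_cells b)" for b by (cases b) auto
  from assms show ?thesis
    by (induction rule: exec.induct) (auto simp: i b)
qed

section \<open>Input, output and space\<close>

text \<open>Initially integer register \<open>0\<close> holds \<open>n\<close>, and cell \<open>i\<close> of real array \<open>0\<close> holds \<open>p i\<close> for
  \<open>i \<in> {1..n}\<close>; \<open>\<Lambda>\<close> is accessible only through \<open>ReadNext\<close>.\<close>

definition init_state :: "nat \<Rightarrow> (nat \<Rightarrow> real) \<Rightarrow> state" where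
  "init_state n p =
     \<lparr>ireg = (\<lambda>r. if r = 0 then int n else 0),
      rreg = (\<lambda>x. 0),
      iarr = (\<lambda>A k. 0),
      rarr = (\<lambda>A k. if A = 0 \<and> k \<in> {1..n} then p k else 0),
      rpos = 0\<rparr>"

definition input_cells :: "nat \<Rightarrow> cell set" where
  "input_cells n = insert (IReg 0) (RCell 0 ` {1..n})"

text \<open>The elements of \<open>\<Lambda>\<close>, and so the lengths of codewords, are not bounded in terms of \<open>n\<close>. A
  codeword is therefore delivered as two integers, its length and the number of which it is the
  binary representation (most significant bit first, padded with leading zeros); together they
  determine it. They are found at position \<open>i\<close> of the integer arrays \<open>0\<close> and \<open>1\<close>.\<close>

definition codeword_value :: "bool list \<Rightarrow> int" where
  "codeword_value w = horner_sum of_bool 2 (rev w)"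

definition outputs_code :: "nat \<Rightarrow> state \<Rightarrow> (nat \<Rightarrow> bool list) \<Rightarrow> bool" where
  "outputs_code n s c \<longleftrightarrow>
     (\<forall>i\<in>{1..n}. iarr s 0 i = int (length (c i)) \<and> iarr s 1 i = codeword_value (c i))"

text \<open>Arrays occupy contiguous storage starting at index \<open>0\<close>: touching a cell is charged with all
  the cells below it, so that a sparse use of large addresses is not free. The input cells are
  charged whether or not they are touched.\<close>

definition occupied :: "cell set \<Rightarrow> cell set" where
  "occupied U = U \<union> {ICell A k | A k. \<exists>m\<ge>k. ICell A m \<in> U}
                   \<union> {RCell A k | A k. \<exists>m\<ge>k. RCell A m \<in> U}"

definition space_used :: "nat \<Rightarrow> cell set \<Rightarrow> nat" where
  "space_used n U = card (occupied (input_cells n \<union> U))"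

lemma finite_occupied:
  assumes "finite U"
  shows "finite (occupied U)"
proof -
  have I: "{ICell A k | A k. \<exists>m\<ge>k. ICell A m \<in> U}
        \<subseteq> (\<Union>x\<in>U. case x of ICell A m \<Rightarrow> ICell A ` {..m} | _ \<Rightarrow> {})" by force
  have R: "{RCell A k | A k. \<exists>m\<ge>k. RCell A m \<in> U}
        \<subseteq> (\<Union>x\<in>U. case x of RCell A m \<Rightarrow> RCell A ` {..m} | _ \<Rightarrow> {})" by force
  have "finite {ICell A k | A k. \<exists>m\<ge>k. ICell A m \<in> U}"
    by (rule finite_subset[OF I]) (use assms in \<open>auto split: cell.splits\<close>)
  moreover have "finite {RCell A k | A k. \<exists>m\<ge>k. RCell A m \<in> U}"
    by (rule finite_subset[OF R]) (use assms in \<open>auto split: cell.splits\<close>)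
  ultimately show ?thesis using assms unfolding occupied_def by blast
qed

end

theory Submission
  imports Defs
begin

text \<open>Go through the levels of the code tree at the lengths \<open>\<lambda>\<^sub>1 < \<lambda>\<^sub>2 < \<dots>\<close> of \<open>\<Lambda>\<close>. A symbol whose
  codeword is not yet complete pays \<open>\<lambda>\<^sub>j - \<lambda>\<^sub>j\<^sub>-\<^sub>1\<close> times its probability between two levels, and any set
  of \<open>r\<close> remaining symbols weighs at least as much as the \<open>r\<close> last ones. So the only information to carry
  from level to level is the number \<open>r\<close> of remaining symbols and the number \<open>m\<close> of available nodes,
  capped at \<open>r\<close>. Every level that does not finish the code decreases \<open>r - m\<close>, because at least one
  node is expanded and has at least two descendants; hence the first \<open>n\<close> elements of \<open>\<Lambda>\<close> suffice. The
  codewords are read off along an optimal path by taking nodes from left to right.\<close>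

section \<open>Codewords and the Kraft inequality\<close>

text \<open>Optimality is a statement about arbitrary codes, which need be neither sorted nor
  canonical. The lower bound therefore uses only the Kraft inequality: the cost is split along the
  levels, and on each level separately the remaining symbols are replaced by equally many of least
  probability. No whole code is rearranged. Only the code that is produced is sorted, and its cost
  is tracked by an exact equation.

  The machine has no infinity for infeasible entries. The offset \<open>B\<close> makes every
  feasible entry negative, so that \<open>0\<close> can stand for infeasible and is also what fresh
  memory contains.

  Competing codes may use lengths beyond \<open>lam K\<close>, which can happen only for
  \<open>K = n\<close>. For them, \<open>r \<le> m\<close> at the last level comes from counting the
  decreases of \<open>r - m\<close>, not from running out of lengths.

  The table has about \<open>K * n ^ 2\<close> entries, each a minimum over at most \<open>n\<close>
  choices. As \<open>K \<le> card \<Lambda>\<close> and \<open>K \<le> n\<close>, the bounds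
  \<open>K * n ^ 3\<close> and \<open>K * n ^ 2\<close> give all bounds of the theorem.\<close>

lemma prefix_code_kraft:
  assumes "prefix_code n c"
  shows "(\<Sum>i=1..n. 1 / 2 ^ length (c i) :: real) \<le> 1"
proof -
  \<comment> \<open>\<open>L\<close> is a common upper bound of the lengths, and \<open>E i\<close>
    consists of the words of length \<open>L\<close> that extend \<open>c i\<close>. Prefix-freeness
    makes these sets disjoint, so their sizes add up to at most \<open>2 ^ L\<close>.\<close>
  define L where "L = (\<Sum>i=1..n. length (c i))"
  define E where "E i = (\<lambda>u. c i @ u) ` {u. length u = L - length (c i)}" for i
  have len: "length (c i) \<le> L" if "i \<in> {1..n}" for i
    unfolding L_def by (rule member_le_sum) (use that in auto)
  have words: "card {u :: bool list. length u = k} = 2 ^ k" "finite {u :: bool list. length u = k}"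
    for k
    using card_lists_length_eq[of "UNIV :: bool set" k] finite_lists_length_eq[of "UNIV :: bool set" k]
    by auto
  have cardE: "card (E i) = 2 ^ (L - length (c i))" for i
    unfolding E_def by (subst card_image) (auto simp: inj_on_def words)
  have disj: "E i \<inter> E j = {}" if "i \<in> {1..n}" "j \<in> {1..n}" "i \<noteq> j" for i j
  proof -
    have "\<not> prefix (c i) (c j)" "\<not> prefix (c j) (c i)"
      using assms that unfolding prefix_code_def by auto
    then have "\<not> (prefix (c i) w \<and> prefix (c j) w)" for w
      using prefix_same_cases by blast
    then show ?thesis
      unfolding E_def by (force simp: prefix_def)
  qed
  have "(\<Sum>i=1..n. card (E i)) = card (\<Union>i\<in>{1..n}. E i)"
    using disj by (subst card_UN_disjoint) (auto simp: E_def words)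
  also have "\<dots> \<le> card {u :: bool list. length u = L}"
    by (rule card_mono) (use len in \<open>auto simp: E_def words\<close>)
  finally have "(\<Sum>i=1..n. 2 ^ (L - length (c i))) \<le> (2 ^ L :: nat)"
    by (simp add: cardE words)
  then have "real (\<Sum>i=1..n. 2 ^ (L - length (c i))) \<le> real (2 ^ L)"
    by (rule of_nat_mono)
  then have "(\<Sum>i=1..n. 2 ^ (L - length (c i)) / 2 ^ L :: real) \<le> 1"
    by (simp add: sum_divide_distrib[symmetric])
  also have "(\<Sum>i=1..n. 2 ^ (L - length (c i)) / 2 ^ L :: real) = (\<Sum>i=1..n. 1 / 2 ^ length (c i))"
    by (intro sum.cong refl) (simp add: len power_diff)
  finally show ?thesis .
qed

definition codeword :: "nat \<Rightarrow> int \<Rightarrow> bool list" where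
  "codeword l v = rev (map (bit v) [0..<l])"

lemma length_codeword [simp]: "length (codeword l v) = l"
  by (simp add: codeword_def)

lemma codeword_value_codeword:
  assumes "0 \<le> v" "v < 2 ^ l"
  shows "codeword_value (codeword l v) = v"
  using assms by (simp add: codeword_value_def codeword_def horner_sum_bit_eq_take_bit take_bit_int_eq_self)

lemma codeword_value_append:
  "codeword_value (u @ w) = codeword_value u * 2 ^ length w + codeword_value w"
  by (simp add: codeword_value_def horner_sum_append)

text \<open>The value has no bits at or above position \<open>length w\<close>, so truncation to
  that many bits leaves it unchanged.\<close>

lemma codeword_value_bounds: "0 \<le> codeword_value w" "codeword_value w < 2 ^ length w"
proof -
  have "codeword_value w = take_bit (length w) (codeword_value w)"
    unfolding codeword_value_def
    by (rule bit_eqI) (auto simp: bit_simps bit_horner_sum_bit_iff)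
  then show "0 \<le> codeword_value w" "codeword_value w < 2 ^ length w"
    by (metis take_bit_nonnegative, metis take_bit_int_less_exp)
qed

section \<open>Canonical codes\<close>

text \<open>On level \<open>lev\<close> of the code tree the next unused node, counted from the left, is \<open>X\<close>.\<close>

definition canonical ::
  "nat set \<Rightarrow> nat \<Rightarrow> int \<Rightarrow> nat \<Rightarrow> (nat \<Rightarrow> int) \<Rightarrow> (nat \<Rightarrow> int) \<Rightarrow> bool" where
  "canonical \<Lambda> q X lev a v \<longleftrightarrow>
     0 \<le> X \<and>
     (\<forall>i\<in>{1..q}. 0 < a i \<and> nat (a i) \<in> \<Lambda> \<and> nat (a i) \<le> lev \<and> 0 \<le> v i \<and> v i < 2 ^ nat (a i) \<and>
        (v i + 1) * 2 ^ (lev - nat (a i)) \<le> X) \<and>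
     (\<forall>i\<in>{1..q}. \<forall>k\<in>{1..q}. i < k \<longrightarrow>
        nat (a i) \<le> nat (a k) \<and> (v i + 1) * 2 ^ (nat (a k) - nat (a i)) \<le> v k)"

text \<open>Node \<open>X\<close> becomes a leaf of level \<open>lev\<close>. By the invariant
  everything placed so far ends to its left, and \<open>X < 2 ^ lev\<close> says that the node
  exists.\<close>

lemma canonical_add:
  assumes "canonical \<Lambda> q X lev a v" and "0 < lev" "lev \<in> \<Lambda>" "X < 2 ^ lev"
  shows "canonical \<Lambda> (Suc q) (X + 1) lev (a(Suc q := int lev)) (v(Suc q := X))"
proof -
  let ?a = "a(Suc q := int lev)" and ?v = "v(Suc q := X)"
  have X: "0 \<le> X"
    and one: "\<And>i. i \<in> {1..q} \<Longrightarrow> 0 < a i \<and> nat (a i) \<in> \<Lambda> \<and> nat (a i) \<le> lev \<and> 0 \<le> v i \<and>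
        v i < 2 ^ nat (a i) \<and> (v i + 1) * 2 ^ (lev - nat (a i)) \<le> X"
    and two: "\<And>i k. i \<in> {1..q} \<Longrightarrow> k \<in> {1..q} \<Longrightarrow> i < k \<Longrightarrow>
        nat (a i) \<le> nat (a k) \<and> (v i + 1) * 2 ^ (nat (a k) - nat (a i)) \<le> v k"
    using assms(1) unfolding canonical_def by auto
  have "0 < ?a i \<and> nat (?a i) \<in> \<Lambda> \<and> nat (?a i) \<le> lev \<and> 0 \<le> ?v i \<and>
      ?v i < 2 ^ nat (?a i) \<and> (?v i + 1) * 2 ^ (lev - nat (?a i)) \<le> X + 1"
    if "i \<in> {1..Suc q}" for i
    using that one[of i] X assms(2-4) by (cases "i = Suc q") auto
  moreover have "nat (?a i) \<le> nat (?a k) \<and> (?v i + 1) * 2 ^ (nat (?a k) - nat (?a i)) \<le> ?v k"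
    if "i \<in> {1..Suc q}" "k \<in> {1..Suc q}" "i < k" for i k
    using that one[of i] two[of i k] by (cases "k = Suc q") auto
  ultimately show ?thesis
    using X unfolding canonical_def by auto
qed

text \<open>\<open>X * 2 ^ (lev' - lev)\<close> is the leftmost descendant of \<open>X\<close> on
  the lower level, so the inequalities with \<open>X\<close> are merely scaled.\<close>

lemma canonical_descend:
  assumes "canonical \<Lambda> q X lev a v" "lev \<le> lev'"
  shows "canonical \<Lambda> q (X * 2 ^ (lev' - lev)) lev' a v"
proof -
  have "(v i + 1) * 2 ^ (lev' - nat (a i)) \<le> X * 2 ^ (lev' - lev)" if i: "i \<in> {1..q}" for i
  proof -
    have a: "nat (a i) \<le> lev" and le: "(v i + 1) * 2 ^ (lev - nat (a i)) \<le> X"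
      using assms(1) i unfolding canonical_def by auto
    have "lev' - nat (a i) = (lev - nat (a i)) + (lev' - lev)" using a assms(2) by simp
    then have "(v i + 1) * 2 ^ (lev' - nat (a i)) = ((v i + 1) * 2 ^ (lev - nat (a i))) * 2 ^ (lev' - lev)"
      by (simp only: power_add mult.assoc)
    also have "\<dots> \<le> X * 2 ^ (lev' - lev)" using le by (intro mult_right_mono) auto
    finally show ?thesis .
  qed
  then show ?thesis using assms unfolding canonical_def by fastforce
qed

text \<open>A word with prefix \<open>c i\<close> has its value in the block of descendants of node
  \<open>v i\<close>. A later codeword lies to the right of that block; an earlier one is at most as
  long, so it would have to be equal, which the strict order of values excludes.\<close>

lemma canonical_code:
  assumes "canonical \<Lambda> n X lev a v"
  defines "c \<equiv> \<lambda>i. codeword (nat (a i)) (v i)"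
  shows "reserved_length_code n \<Lambda> c"
    and "i \<in> {1..n} \<Longrightarrow> int (length (c i)) = a i \<and> codeword_value (c i) = v i"
proof -
  show val: "int (length (c i)) = a i \<and> codeword_value (c i) = v i" if "i \<in> {1..n}" for i
  proof -
    have "0 < a i" "0 \<le> v i" "v i < 2 ^ nat (a i)"
      using assms(1) that unfolding canonical_def by auto
    then show ?thesis by (simp add: c_def codeword_value_codeword)
  qed
  have *: "\<not> prefix (c i) (c k)" if i: "i \<in> {1..n}" "k \<in> {1..n}" "i \<noteq> k" for i k
  proof
    assume "prefix (c i) (c k)"
    then obtain w where w: "c k = c i @ w" by (auto simp: prefix_def)
    then have lw: "nat (a k) = nat (a i) + length w"
      unfolding c_def by (metis length_append length_codeword)
    have vk: "v k = v i * 2 ^ length w + codeword_value w"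
      using val i w by (metis codeword_value_append)
    show False
    proof (cases "i < k")
      case True
      then have "(v i + 1) * 2 ^ length w \<le> v k"
        using assms i lw unfolding canonical_def by (metis add_diff_cancel_left')
      then show False using vk codeword_value_bounds(2)[of w] by (simp add: algebra_simps)
    next
      case False
      then have "k < i" using i by simp
      then have "nat (a k) \<le> nat (a i)" "(v k + 1) * 2 ^ (nat (a i) - nat (a k)) \<le> v i"
        using assms i unfolding canonical_def by auto
      then have "w = []" "v k + 1 \<le> v i" using lw by auto
      then show False using vk by (simp add: codeword_value_def)
    qed
  qed
  then show "reserved_length_code n \<Lambda> c"
    using assms(1) unfolding reserved_length_code_def prefix_code_def canonical_def
    by (auto simp: c_def)
qed

section \<open>The dynamic program\<close>

text \<open>The base value \<open>0\<close> stands for infinity: only negative candidates are of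
  interest, because a nonnegative one marks a configuration without a code.\<close>

primrec running_min :: "(nat \<Rightarrow> real) \<Rightarrow> nat \<Rightarrow> real" where
  "running_min f 0 = 0"
| "running_min f (Suc k) = min (running_min f k) (f k)"

lemma running_min_le: "s < k \<Longrightarrow> running_min f k \<le> f s"
  by (induction k) (auto simp: less_Suc_eq min_def)

locale reserved_instance =
  fixes n :: nat and p :: "nat \<Rightarrow> real" and \<Lambda> :: "nat set"
  assumes valid: "valid_instance n p \<Lambda>"
begin

lemma n_pos: "1 \<le> n"
  and p_anti: "\<lbrakk>1 \<le> i; i \<le> j; j \<le> n\<rbrakk> \<Longrightarrow> p j \<le> p i"
  and p_nonneg: "i \<in> {1..n} \<Longrightarrow> 0 \<le> p i"
  and p_sum: "(\<Sum>i=1..n. p i) = 1"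
  and pos: "l \<in> \<Lambda> \<Longrightarrow> 0 < l"
  and large: "\<exists>l\<in>\<Lambda>. log 2 (real n) \<le> real l"
  using valid unfolding valid_instance_def by (auto simp: less_imp_le)

text \<open>At most \<open>n\<close> elements of \<open>\<Lambda>\<close> are ever read: \<open>K\<close> of them are used.\<close>

definition K :: nat where
  "K = (if finite \<Lambda> then min n (card \<Lambda>) else n)"

text \<open>Index \<open>0\<close> stands for the root. Indices above \<open>K\<close> give
  \<open>0\<close>, which is what array \<open>2\<close> contains there: the end marker of a finite
  \<open>\<Lambda>\<close>, or a cell that was never written.\<close>

definition lam :: "nat \<Rightarrow> nat" where
  "lam i = (if 1 \<le> i \<and> i \<le> n then input_elem \<Lambda> (i - 1) else 0)"

section \<open>The sequence of usable lengths\<close>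

lemma nonempty: "\<Lambda> \<noteq> {}"
  using large by auto

lemma K_pos: "1 \<le> K"
  using nonempty n_pos by (auto simp: K_def Suc_le_eq card_gt_0_iff)

lemma K_le: "K \<le> n" and K_le_card: "finite \<Lambda> \<Longrightarrow> K \<le> card \<Lambda>"
  by (auto simp: K_def)

lemma lam_eq: "1 \<le> i \<Longrightarrow> i \<le> K \<Longrightarrow> lam i = enumerate \<Lambda> (i - 1)"
  by (auto simp: K_def lam_def input_elem_def split: if_splits)

lemma lam_0 [simp]: "lam 0 = 0"
  by (simp add: lam_def)

lemma lam_in: "1 \<le> i \<Longrightarrow> i \<le> K \<Longrightarrow> lam i \<in> \<Lambda>"
  using K_le_card
  by (cases "finite \<Lambda>") (simp_all add: lam_eq enumerate_in_set finite_enumerate_in_set)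

lemma lam_beyond: "K < i \<Longrightarrow> lam i = 0"
  by (auto simp: K_def lam_def input_elem_def split: if_splits)

lemma lam_less: "i < j \<Longrightarrow> j \<le> K \<Longrightarrow> lam i < lam j"
proof (cases "i = 0")
  case True
  assume "i < j" "j \<le> K"
  then show ?thesis using True lam_in[of j] pos[of "lam j"] by simp
next
  case False
  assume "i < j" "j \<le> K"
  then show ?thesis using False K_le_card
    by (cases "finite \<Lambda>") (simp_all add: lam_eq finite_enumerate_mono)
qed

lemma lam_le: "i \<le> j \<Longrightarrow> j \<le> K \<Longrightarrow> lam i \<le> lam j"
  using lam_less[of i j] by (cases "i = j") auto

lemma lam_ge: "j \<le> K \<Longrightarrow> j \<le> lam j"
proof (induction j)
  case (Suc j)
  then show ?case using lam_less[of j "Suc j"] by simp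
qed simp

lemma element_of_index:
  assumes "x \<in> \<Lambda>"
  obtains i where "enumerate \<Lambda> i = x" "finite \<Lambda> \<Longrightarrow> i < card \<Lambda>"
proof (cases "finite \<Lambda>")
  case True
  then show ?thesis using assms that finite_enumerate_Ex[of \<Lambda> x] by blast
next
  case False
  then show ?thesis using assms that enumerate_Ex[of \<Lambda> x] by blast
qed

text \<open>No length is skipped, so a symbol that is not finished at level \<open>j\<close> is
  still alive at level \<open>j + 1\<close>.\<close>

lemma lam_gap:
  assumes "x \<in> \<Lambda>" "lam j < x" "j < K"
  shows "lam (Suc j) \<le> x"
proof -
  obtain i where i: "enumerate \<Lambda> i = x" "finite \<Lambda> \<Longrightarrow> i < card \<Lambda>"
    using element_of_index[OF assms(1)] by blast
  have eq: "lam (Suc j) = enumerate \<Lambda> j" using assms by (simp add: lam_eq)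
  have jc: "finite \<Lambda> \<Longrightarrow> j < card \<Lambda>" using assms(3) K_le_card by simp
  have "j \<le> i"
  proof (rule ccontr)
    assume "\<not> j \<le> i"
    then have "i \<le> j - 1" "1 \<le> j" by auto
    then have "enumerate \<Lambda> i \<le> enumerate \<Lambda> (j - 1)"
      using jc i(2) by (cases "finite \<Lambda>") (auto simp: le_less finite_enumerate_mono)
    then show False using assms i \<open>1 \<le> j\<close> lam_eq[of j] by simp
  qed
  then show ?thesis
    unfolding eq i(1)[symmetric] using jc i(2) by (cases "finite \<Lambda>") (auto simp: le_less)
qed

lemma levels_suffice: "K = n \<or> (\<forall>x\<in>\<Lambda>. x \<le> lam K)"
proof (cases "K = n")
  case False
  then have fin: "finite \<Lambda>" "K = card \<Lambda>" by (auto simp: K_def split: if_splits)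
  have "x \<le> lam K" if x: "x \<in> \<Lambda>" for x
  proof -
    obtain i where i: "enumerate \<Lambda> i = x" "i < card \<Lambda>"
      using element_of_index[OF x] fin(1) by metis
    then have "i \<le> K - 1" using fin by simp
    then have "enumerate \<Lambda> i \<le> enumerate \<Lambda> (K - 1)"
      using fin K_pos i by (auto simp: le_less)
    then show ?thesis using i lam_eq[of K] K_pos by simp
  qed
  then show ?thesis by blast
qed simp

text \<open>Makes the code with all lengths \<open>lam K\<close> possible. For \<open>K = n\<close>
  it follows from \<open>n \<le> lam n\<close> and \<open>n < 2 ^ n\<close>; otherwise
  \<open>lam K\<close> bounds all of \<open>\<Lambda>\<close>, including the element that is at
  least \<open>log 2 n\<close>.\<close>

lemma n_le_power: "n \<le> 2 ^ lam K"
proof -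
  have "log 2 (real n) \<le> lam K"
    using levels_suffice
  proof
    assume "K = n"
    have "log 2 (real n) \<le> log 2 (2 ^ n)"
      using n_pos of_nat_less_two_power[of n, where ?'a = real] by (intro log_mono) auto
    then show ?thesis using lam_ge[of K] \<open>K = n\<close> by simp
  next
    assume "\<forall>x\<in>\<Lambda>. x \<le> lam K"
    then show ?thesis using large by fastforce
  qed
  then have "real n \<le> 2 powr lam K"
    using n_pos by (simp add: log_le_iff)
  also have "\<dots> = real (2 ^ lam K)" by (simp add: powr_realpow)
  finally show ?thesis by (simp only: of_nat_le_iff)
qed

section \<open>The weight of the least probable symbols\<close>

definition tail :: "nat \<Rightarrow> real" where
  "tail r = (\<Sum>i\<in>{n-r<..n}. p i)"

lemma tail_0 [simp]: "tail 0 = 0"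
  by (simp add: tail_def)

lemma tail_Suc: "r < n \<Longrightarrow> tail (Suc r) = tail r + p (n - r)"
proof -
  assume "r < n"
  then have "{n - Suc r<..n} = insert (n - r) {n - r<..n}" by auto
  then show ?thesis by (simp add: tail_def)
qed

lemma tail_nonneg: "0 \<le> tail r"
  unfolding tail_def by (intro sum_nonneg p_nonneg) auto

text \<open>Exchange argument: with \<open>B\<close> the last \<open>card A\<close> indices,
  \<open>A - B\<close> and \<open>B - A\<close> have equally many elements, and
  \<open>p (n - card A)\<close> separates their probabilities.\<close>

lemma tail_le:
  assumes "A \<subseteq> {1..n}"
  shows "tail (card A) \<le> sum p A"
proof -
  define B where "B = {n - card A<..n}"
  have fA: "finite A" using assms finite_subset by blast
  have "card A \<le> n" using card_mono[OF _ assms] by simp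
  then have cB: "card B = card A" by (simp add: B_def)
  have fB: "finite B" by (simp add: B_def)
  have "card (B - A) = card (A - B)"
    using card_Diff_subset_Int[of B A] card_Diff_subset_Int[of A B] fA fB cB by (simp add: Int_commute)
  have "sum p (B - A) \<le> sum p (A - B)"
  proof (cases "A - B = {}")
    case True
    then have "B - A = {}" using \<open>card (B - A) = card (A - B)\<close> fB
      by (metis card.empty card_0_eq finite_Diff)
    then show ?thesis using True by simp
  next
    case False
    then obtain a where "a \<in> A" "a \<notin> B" by blast
    then have q: "1 \<le> n - card A" using assms by (auto simp: B_def)
    have "sum p (B - A) \<le> real (card (B - A)) * p (n - card A)"
      by (rule sum_bounded_above) (use q in \<open>auto simp: B_def intro!: p_anti\<close>)
    also have "\<dots> = real (card (A - B)) * p (n - card A)"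
      using \<open>card (B - A) = card (A - B)\<close> by simp
    also have "\<dots> \<le> sum p (A - B)"
      by (rule sum_bounded_below) (use assms in \<open>auto simp: B_def intro!: p_anti\<close>)
    finally show ?thesis .
  qed
  moreover have "sum p A = sum p (A \<inter> B) + sum p (A - B)"
    using fA sum.Int_Diff by blast
  moreover have "sum p B = sum p (A \<inter> B) + sum p (B - A)"
    using fB sum.Int_Diff[of B p A] by (simp add: Int_commute)
  ultimately show ?thesis by (simp add: tail_def B_def)
qed

text \<open>If \<open>k\<close> nodes of level \<open>lam j\<close> are expanded for \<open>r\<close> remaining symbols, then \<open>slots j r k\<close> nodes are
  available at the next level; more than \<open>r\<close> are never needed.\<close>

definition slots :: "nat \<Rightarrow> nat \<Rightarrow> nat \<Rightarrow> nat" where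
  "slots j r k = min r ((k * 2 ^ lam (Suc j)) div 2 ^ lam j)"

lemma slots_le: "slots j r k \<le> r"
  by (simp add: slots_def)

text \<open>Between consecutive usable lengths the division is exact. For \<open>j = K\<close> the
  next length is \<open>0\<close> and the quotient is meaningless, but there \<open>slots\<close>
  only selects an entry of the vanishing layer \<open>val 0\<close>.\<close>

lemma slots_eq:
  assumes "j < K"
  shows "slots j r k = min r (k * 2 ^ (lam (Suc j) - lam j))"
proof -
  have "lam j \<le> lam (Suc j)" using lam_le assms by simp
  then have "(2::nat) ^ lam (Suc j) = 2 ^ (lam (Suc j) - lam j) * 2 ^ lam j"
    by (simp flip: power_add)
  then have "k * 2 ^ lam (Suc j) div 2 ^ lam j = k * 2 ^ (lam (Suc j) - lam j)"
    by (metis mult.assoc nonzero_mult_div_cancel_right power_not_zero zero_neq_numeral)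
  then show ?thesis by (simp add: slots_def)
qed

text \<open>Lengths increase strictly, so an expanded node has at least two descendants. This is the
  source of the decrease of \<open>r - m\<close>.\<close>

lemma slots_double:
  assumes "j < K"
  shows "min r (2 * k) \<le> slots j r k"
proof -
  have "(2::nat) ^ 1 \<le> 2 ^ (lam (Suc j) - lam j)"
    using lam_less[of j "Suc j"] assms by (intro power_increasing) auto
  then have "2 * k \<le> k * 2 ^ (lam (Suc j) - lam j)" by (simp add: mult.commute)
  then have "min r (2 * k) \<le> min r (k * 2 ^ (lam (Suc j) - lam j))"
    by (intro min.mono order_refl)
  then show ?thesis using assms by (simp add: slots_eq)
qed

text \<open>Exceeds the cost of every code all of whose codewords have length at most \<open>lam K\<close>.\<close>

definition B :: real where
  "B = real (lam K) + 1"

text \<open>\<open>val d r m + B\<close> is the least cost of placing the \<open>r\<close> last symbols when \<open>m\<close> nodes are available at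
  level \<open>lam (K + 1 - d)\<close>, a codeword being charged for its part below level \<open>lam (K - d)\<close>.
  Infeasible configurations cost at least \<open>B\<close>, so that nonnegative values mean that no
  code is available. The offset \<open>B\<close> makes the layer \<open>d = 0\<close> vanish.\<close>

primrec val :: "nat \<Rightarrow> nat \<Rightarrow> nat \<Rightarrow> real" where
  "val 0 = (\<lambda>r m. 0)"
| "val (Suc d) = (\<lambda>r m. (real (lam (K - d)) - real (lam (K - Suc d))) * tail r +
     (if r \<le> m then - B
      else running_min (\<lambda>s. val d (r - s) (slots (K - d) (r - s) (m - s))) m))"

lemma val_lower_bound:
  assumes "d < K" "A \<subseteq> {1..n}" "card A = r"
    and "\<forall>i\<in>A. l i \<in> \<Lambda> \<and> lam (K - d) \<le> l i"
    and "(\<forall>i\<in>A. l i \<le> lam K) \<or> r \<le> m + d"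
    and "(\<Sum>i\<in>A. 2 ^ lam (K - d) / 2 ^ l i) \<le> real m"
  shows "val (Suc d) r m \<le> (\<Sum>i\<in>A. p i * (real (l i) - real (lam (K - Suc d)))) - B"
  using assms
proof (induction d arbitrary: A r m)
  case 0
  \<comment> \<open>Either the surplus bound says so with \<open>d = 0\<close>, or all lengths equal
    \<open>lam K\<close>, and then the Kraft sum is \<open>r\<close>.\<close>
  have "r \<le> m"
  proof (cases "r \<le> m + 0")
    case False
    then have "\<forall>i\<in>A. l i = lam K" using 0 by (metis diff_zero le_antisym)
    then have "real r \<le> real m" using 0(3,6) by simp
    then show ?thesis by simp
  qed simp
  have "(real (lam K) - real (lam (K - 1))) * tail r \<le> (real (lam K) - real (lam (K - 1))) * sum p A"
    using tail_le[OF 0(2)] 0(3) lam_le[of "K-1" K] by (intro mult_left_mono) auto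
  also have "\<dots> = (\<Sum>i\<in>A. p i * (real (lam K) - real (lam (K - 1))))"
    by (simp only: sum_distrib_right[symmetric] mult.commute)
  also have "\<dots> \<le> (\<Sum>i\<in>A. p i * (real (l i) - real (lam (K - 1))))"
    using 0(2,4) p_nonneg by (intro sum_mono mult_left_mono) auto
  finally show ?case using \<open>r \<le> m\<close> by simp
next
  case (Suc d)
  define j where "j = K - Suc d"
  have j: "j < K" "K - d = Suc j" "K - Suc (Suc d) = j - 1" "1 \<le> j"
    using Suc.prems(1) by (auto simp: j_def)
  have fA: "finite A" using Suc.prems(2) finite_subset by blast
  have lj: "lam (j - 1) \<le> lam j" using j lam_le[of "j-1" j] by simp
  let ?w = "real (lam j) - real (lam (j - 1))"
  have tA: "?w * tail r \<le> (\<Sum>i\<in>A. p i * ?w)"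
    using tail_le[OF Suc.prems(2)] Suc.prems(3) lj
    unfolding sum_distrib_right[symmetric] mult.commute[of ?w] by (intro mult_right_mono) auto
  have lA: "l i \<in> \<Lambda>" "lam j \<le> l i" if "i \<in> A" for i
    using Suc.prems(4) that by (auto simp: j_def)
  have pA: "0 \<le> p i" if "i \<in> A" for i using p_nonneg Suc.prems(2) that by auto
  have val: "val (Suc (Suc d)) r m = ?w * tail r +
     (if r \<le> m then - B
      else running_min (\<lambda>s. val (Suc d) (r - s) (slots j (r - s) (m - s))) m)"
    using j by (simp add: j_def del: val.simps(2) add: val.simps(2)[of "Suc d"])
  show ?case
  proof (cases "r \<le> m")
    case True
    note tA
    also have "(\<Sum>i\<in>A. p i * ?w) \<le> (\<Sum>i\<in>A. p i * (real (l i) - real (lam (j - 1))))"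
      using lA pA by (intro sum_mono mult_left_mono) auto
    finally show ?thesis using True unfolding val j by simp
  next
    case False
    \<comment> \<open>\<open>S\<close> collects the symbols whose codewords end at this level, each
      taking one node; its size \<open>s\<close> is the candidate with which
      \<open>running_min\<close> is compared.\<close>
    define S where "S = {i\<in>A. l i = lam j}"
    define A' where "A' = A - S"
    define s where "s = card S"
    have S: "S \<subseteq> A" "finite S" using fA by (auto simp: S_def)
    have A': "A' \<subseteq> {1..n}" "finite A'" using Suc.prems(2) fA by (auto simp: A'_def)
    have cA': "card A' = r - s" unfolding A'_def s_def using S Suc.prems(3) by (simp add: card_Diff_subset)
    have "(\<Sum>i\<in>A. 2 ^ lam j / 2 ^ l i :: real) = (\<Sum>i\<in>A'. 2 ^ lam j / 2 ^ l i) + (\<Sum>i\<in>S. 2 ^ lam j / 2 ^ l i)"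
      unfolding A'_def using S fA by (simp add: sum.subset_diff)
    also have "(\<Sum>i\<in>S. 2 ^ lam j / 2 ^ l i :: real) = s"
      by (simp add: S_def s_def)
    finally have kr: "(\<Sum>i\<in>A'. 2 ^ lam j / 2 ^ l i :: real) \<le> real m - real s"
      using Suc.prems(6) by (simp add: j_def)
    \<comment> \<open>\<open>running_min\<close> ranges over \<open>s < m\<close> only. At least one
      node must stay free for the remaining symbols, because their Kraft sum is positive.\<close>
    have "s < m"
    proof (cases "A' = {}")
      case True
      then have "A = S" using S by (auto simp: A'_def)
      then have "s = r" using Suc.prems(3) s_def by simp
      then show ?thesis using kr True False by simp
    next
      case False
      have "0 < (\<Sum>i\<in>A'. 2 ^ lam j / 2 ^ l i :: real)"
        by (rule sum_pos) (use False A' in auto)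
      then show ?thesis using kr by simp
    qed
    define m' where "m' = slots j (r - s) (m - s)"
    have lA': "l i \<in> \<Lambda>" "lam (Suc j) \<le> l i" if "i \<in> A'" for i
      using that lA[of i] lam_gap[of "l i" j] j by (auto simp: A'_def S_def)
    have IH: "val (Suc d) (r - s) m' \<le> (\<Sum>i\<in>A'. p i * (real (l i) - real (lam (K - Suc d)))) - B"
    proof (rule Suc.IH)
      show "(\<Sum>i\<in>A'. 2 ^ lam (K - d) / 2 ^ l i) \<le> real m'"
      proof -
        \<comment> \<open>The Kraft sum of the rest is bounded twice: by the number of symbols, as
          each term is at most \<open>1\<close>, and by the number of descendants. The smaller bound
          is \<open>slots\<close>.\<close>
        have "(\<Sum>i\<in>A'. 2 ^ lam (Suc j) / 2 ^ l i :: real) \<le> (\<Sum>i\<in>A'. 1)"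
          using lA' by (intro sum_mono) simp
        then have 1: "(\<Sum>i\<in>A'. 2 ^ lam (Suc j) / 2 ^ l i :: real) \<le> r - s" using cA' by simp
        have "lam j \<le> lam (Suc j)" using lam_le[of j "Suc j"] j by simp
        then have "(2::real) ^ lam (Suc j) = 2 ^ (lam (Suc j) - lam j) * 2 ^ lam j"
          by (simp flip: power_add)
        then have "(\<Sum>i\<in>A'. 2 ^ lam (Suc j) / 2 ^ l i :: real)
            = 2 ^ (lam (Suc j) - lam j) * (\<Sum>i\<in>A'. 2 ^ lam j / 2 ^ l i)"
          by (simp add: sum_distrib_left)
        also have "\<dots> \<le> 2 ^ (lam (Suc j) - lam j) * (real m - real s)"
          using kr by (intro mult_left_mono) auto
        also have "\<dots> = real ((m - s) * 2 ^ (lam (Suc j) - lam j))"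
          using \<open>s < m\<close> by simp
        finally show ?thesis
          using 1 unfolding m'_def slots_eq[OF j(1)] of_nat_min j(2) by (rule min.boundedI[rotated])
      qed
      show "(\<forall>i\<in>A'. l i \<le> lam K) \<or> r - s \<le> m' + d"
        using Suc.prems(5)
      proof
        assume "r \<le> m + Suc d"
        \<comment> \<open>As \<open>m - s \<ge> 1\<close>, doubling the expanded nodes lowers the
          surplus by at least one, which pays for the smaller \<open>d\<close>.\<close>
        moreover have "min (r - s) (2 * (m - s)) \<le> m'" unfolding m'_def using slots_double j by blast
        ultimately show ?thesis using \<open>s < m\<close> by linarith
      qed (auto simp: A'_def)
    qed (use lA' A' j cA' Suc.prems(1) in auto)
    have "running_min (\<lambda>s. val (Suc d) (r - s) (slots j (r - s) (m - s))) m \<le> val (Suc d) (r - s) m'"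
      unfolding m'_def by (rule running_min_le[OF \<open>s < m\<close>])
    also note IH
    \<comment> \<open>Symbols in \<open>S\<close> contribute \<open>0\<close> below level
      \<open>lam j\<close>, so they can be added back.\<close>
    also have "(\<Sum>i\<in>A'. p i * (real (l i) - real (lam (K - Suc d)))) =
       (\<Sum>i\<in>A. p i * (real (l i) - real (lam j)))"
      unfolding j_def[symmetric] by (rule sum.mono_neutral_left) (auto simp: fA A'_def S_def)
    finally have "val (Suc (Suc d)) r m \<le> (\<Sum>i\<in>A. p i * ?w) +
        (\<Sum>i\<in>A. p i * (real (l i) - real (lam j))) - B"
      using False tA unfolding val by simp
    also have "\<dots> = (\<Sum>i\<in>A. p i * (real (l i) - real (lam (j - 1)))) - B"
      by (simp add: sum.distrib[symmetric] algebra_simps)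
    finally show ?thesis using j by simp
  qed
qed

section \<open>The value at the root and optimality\<close>

definition root_slots :: nat where
  "root_slots = min n (2 ^ lam 1)"

text \<open>The level bound at the first level. For \<open>K = n\<close> the surplus
  \<open>n - root_slots\<close> is at most \<open>n - 1\<close>, the number of levels that follow,
  since at least one node is available.\<close>

lemma val_root_le:
  assumes "\<forall>i\<in>{1..n}. l i \<in> \<Lambda>" "(\<Sum>i=1..n. 1 / 2 ^ l i :: real) \<le> 1"
  shows "val K n root_slots \<le> (\<Sum>i=1..n. p i * real (l i)) - B"
proof -
  obtain d where d: "K = Suc d" using K_pos by (cases K) auto
  have l1: "lam 1 \<le> l i" if "i \<in> {1..n}" for i
    using lam_gap[of "l i" 0] assms(1) pos that K_pos by (simp add: Suc_le_eq)
  have "val (Suc d) n root_slots \<le> (\<Sum>i\<in>{1..n}. p i * (real (l i) - real (lam (K - Suc d)))) - B"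
  proof (rule val_lower_bound)
    show "(\<forall>i\<in>{1..n}. l i \<le> lam K) \<or> n \<le> root_slots + d"
    proof (cases "K = n")
      case True
      have "1 \<le> root_slots" using n_pos by (simp add: root_slots_def)
      then show ?thesis using True d by simp
    next
      case False
      then show ?thesis using levels_suffice assms(1) by auto
    qed
    have "(\<Sum>i=1..n. 2 ^ lam 1 / 2 ^ l i :: real) \<le> (\<Sum>i=1..n. 1)"
      using l1 by (intro sum_mono) simp
    moreover have "(\<Sum>i=1..n. 2 ^ lam 1 / 2 ^ l i :: real) = 2 ^ lam 1 * (\<Sum>i=1..n. 1 / 2 ^ l i)"
      by (simp add: sum_distrib_left)
    moreover have "\<dots> \<le> 2 ^ lam 1 * 1" using assms(2) by (intro mult_left_mono) auto
    ultimately show "(\<Sum>i=1..n. 2 ^ lam (K - d) / 2 ^ l i) \<le> real root_slots"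
      using d by (simp add: root_slots_def of_nat_min)
  qed (use d assms(1) l1 in auto)
  then show ?thesis using d by simp
qed

text \<open>Length \<open>lam K\<close> for every symbol satisfies the Kraft inequality and costs
  \<open>lam K = B - 1\<close>, so the path to be traced starts at a feasible entry.\<close>

lemma val_root_neg: "val K n root_slots < 0"
proof -
  have "(\<Sum>i=1..n. 1 / 2 ^ lam K :: real) = real n / 2 ^ lam K" by simp
  also have "real n \<le> real (2 ^ lam K)" using n_le_power by (simp only: of_nat_le_iff)
  then have "real n / 2 ^ lam K \<le> 1" by simp
  finally have "val K n root_slots \<le> (\<Sum>i=1..n. p i * real (lam K)) - B"
    using lam_in[of K] K_pos by (intro val_root_le) auto
  also have "(\<Sum>i=1..n. p i * real (lam K)) = real (lam K)"
    using p_sum by (simp add: sum_distrib_right[symmetric])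
  finally show ?thesis by (simp add: B_def)
qed

lemma optimal_of_val:
  assumes "reserved_length_code n \<Lambda> c" "code_cost n p c = val K n root_slots + B"
  shows "optimal_reserved_length_code n p \<Lambda> c"
  unfolding optimal_reserved_length_code_def
proof (intro conjI allI impI assms(1))
  fix c' assume c': "reserved_length_code n \<Lambda> c'"
  then have "val K n root_slots \<le> (\<Sum>i=1..n. p i * real (length (c' i))) - B"
    by (intro val_root_le prefix_code_kraft) (auto simp: reserved_length_code_def)
  then show "code_cost n p c \<le> code_cost n p c'"
    using assms(2) by (simp add: code_cost_def)
qed

text \<open>Layer \<open>d\<close> belongs to level \<open>K + 1 - d\<close>, hence the argument of
  \<open>slots\<close>. If \<open>m < r\<close> and every candidate is positive, no \<open>s\<close>
  qualifies; such entries are infeasible.\<close>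

definition good_choice :: "nat \<Rightarrow> nat \<Rightarrow> nat \<Rightarrow> nat \<Rightarrow> bool" where
  "good_choice d r m s \<longleftrightarrow>
     (if r \<le> m then s = r
      else s < m \<and> running_min (\<lambda>s. val (d - 1) (r - s) (slots (K + 1 - d) (r - s) (m - s))) m
             = val (d - 1) (r - s) (slots (K + 1 - d) (r - s) (m - s)))"

end

section \<open>Reasoning about programs\<close>

text \<open>Total correctness with a time budget \<open>T\<close> and a set \<open>V\<close> of
  admissible cells. The budget is an upper bound, so loops and branches can be rounded up.\<close>

definition run :: "nat set \<Rightarrow> cell set \<Rightarrow> com \<Rightarrow> state \<Rightarrow> nat \<Rightarrow> (state \<Rightarrow> bool) \<Rightarrow> bool" where
  "run \<Lambda> V c s T Q \<longleftrightarrow> (\<exists>t U s'. exec \<Lambda> c s t U s' \<and> t \<le> T \<and> U \<subseteq> V \<and> Q s')"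

lemma run_mono:
  "\<lbrakk>run \<Lambda> V c s T Q; T \<le> T'; \<And>s'. Q s' \<Longrightarrow> Q' s'\<rbrakk> \<Longrightarrow> run \<Lambda> V c s T' Q'"
  unfolding run_def by (meson order_trans)

lemma run_Seq:
  assumes "run \<Lambda> V c s T Q" "\<And>s'. Q s' \<Longrightarrow> run \<Lambda> V c' s' T' Q'"
  shows "run \<Lambda> V (Seq c c') s (T + T') Q'"
proof -
  obtain t U s' where 1: "exec \<Lambda> c s t U s'" "t \<le> T" "U \<subseteq> V" "Q s'"
    using assms(1) by (auto simp: run_def)
  obtain t' U' s'' where 2: "exec \<Lambda> c' s' t' U' s''" "t' \<le> T'" "U' \<subseteq> V" "Q' s''"
    using assms(2)[OF 1(4)] by (auto simp: run_def)
  show ?thesis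
    unfolding run_def using exec_Seq[OF 1(1) 2(1)] 1 2 by (meson Un_least add_mono)
qed

text \<open>Symbolic execution of loop-free code, to be unfolded by the simplifier. Loops give
  \<open>False\<close> because they are treated by \<open>run_While\<close>.\<close>

fun wp :: "nat set \<Rightarrow> cell set \<Rightarrow> com \<Rightarrow> (state \<Rightarrow> bool) \<Rightarrow> state \<Rightarrow> bool" where
  "wp \<Lambda> V (Basic i) Q s \<longleftrightarrow> enabled i s \<and> instr_cells i s \<subseteq> V \<and> Q (step \<Lambda> i s)"
| "wp \<Lambda> V (Seq a b) Q s \<longleftrightarrow> wp \<Lambda> V a (wp \<Lambda> V b Q) s"
| "wp \<Lambda> V (Cond b c d) Q s \<longleftrightarrow>
     test_cells b \<subseteq> V \<and> (if holds b s then wp \<Lambda> V c Q s else wp \<Lambda> V d Q s)"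
| "wp \<Lambda> V (While b c) Q s \<longleftrightarrow> False"

fun run_time :: "com \<Rightarrow> nat" where
  "run_time (Basic i) = 1"
| "run_time (Seq a b) = run_time a + run_time b"
| "run_time (Cond b c d) = 1 + max (run_time c) (run_time d)"
| "run_time (While b c) = 0"

lemma run_Basic: "wp \<Lambda> V (Basic i) Q s \<Longrightarrow> run \<Lambda> V (Basic i) s 1 Q"
  unfolding run_def using exec_Basic[of i s \<Lambda>] by fastforce

lemma run_Cond:
  assumes "test_cells b \<subseteq> V" "holds b s \<Longrightarrow> run \<Lambda> V c s T Q" "\<not> holds b s \<Longrightarrow> run \<Lambda> V d s T Q"
  shows "run \<Lambda> V (Cond b c d) s (1 + T) Q"
proof (cases "holds b s")
  case True
  then obtain t U s' where "exec \<Lambda> c s t U s'" "t \<le> T" "U \<subseteq> V" "Q s'"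
    using assms(2) by (auto simp: run_def)
  then show ?thesis
    unfolding run_def using exec_CondT[OF True, of \<Lambda> c t U s' d] assms(1)
    by (meson Un_least add_left_mono)
next
  case False
  then obtain t U s' where "exec \<Lambda> d s t U s'" "t \<le> T" "U \<subseteq> V" "Q s'"
    using assms(3) by (auto simp: run_def)
  then show ?thesis
    unfolding run_def using exec_CondF[OF False, of \<Lambda> d t U s' c] assms(1)
    by (meson Un_least add_left_mono)
qed

lemma run_wp: "wp \<Lambda> V c Q s \<Longrightarrow> run \<Lambda> V c s (run_time c) Q"
proof (induction c arbitrary: s Q)
  case (Basic i)
  then show ?case using run_Basic by simp
next
  case (Seq a b)
  show ?case using run_Seq[OF Seq.IH(1) Seq.IH(2)] Seq.prems by simp
next
  case (Cond b c d)
  have "run \<Lambda> V c s (max (run_time c) (run_time d)) Q" if "holds b s"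
    by (rule run_mono[OF Cond.IH(1)]) (use Cond.prems that in auto)
  moreover have "run \<Lambda> V d s (max (run_time c) (run_time d)) Q" if "\<not> holds b s"
    by (rule run_mono[OF Cond.IH(2)]) (use Cond.prems that in auto)
  ultimately show ?case
    using Cond.prems run_Cond by simp
qed simp

section \<open>What a program leaves unchanged\<close>

datatype var = IVar nat | RVar nat | IArr nat | RArr nat | Input

fun instr_writes :: "instr \<Rightarrow> var set" where
  "instr_writes (IConst r v) = {IVar r}"
| "instr_writes (ICopy r a) = {IVar r}"
| "instr_writes (IAdd r a b) = {IVar r}"
| "instr_writes (IShl r a b) = {IVar r}"
| "instr_writes (IShr r a b) = {IVar r}"
| "instr_writes (ILoad r A k) = {IVar r}"
| "instr_writes (IStore A k r) = {IArr A}"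
| "instr_writes (ReadNext r) = {IVar r, Input}"
| "instr_writes (RConst x v) = {RVar x}"
| "instr_writes (RCopy x y) = {RVar x}"
| "instr_writes (ROfInt x r) = {RVar x}"
| "instr_writes (RAdd x y z) = {RVar x}"
| "instr_writes (RMul x y z) = {RVar x}"
| "instr_writes (RLoad x A k) = {RVar x}"
| "instr_writes (RStore A k x) = {RArr A}"

fun writes :: "com \<Rightarrow> var set" where
  "writes (Basic i) = instr_writes i"
| "writes (Seq a b) = writes a \<union> writes b"
| "writes (Cond b c d) = writes c \<union> writes d"
| "writes (While b c) = writes c"

definition frame :: "var set \<Rightarrow> state \<Rightarrow> state \<Rightarrow> bool" where
  "frame W s s' \<longleftrightarrow>
     (\<forall>r. IVar r \<notin> W \<longrightarrow> ireg s' r = ireg s r) \<and>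
     (\<forall>x. RVar x \<notin> W \<longrightarrow> rreg s' x = rreg s x) \<and>
     (\<forall>A. IArr A \<notin> W \<longrightarrow> iarr s' A = iarr s A) \<and>
     (\<forall>A. RArr A \<notin> W \<longrightarrow> rarr s' A = rarr s A)"

lemma frame_refl: "frame W s s"
  by (simp add: frame_def)

lemma frame_trans: "frame W s s' \<Longrightarrow> frame W s' s'' \<Longrightarrow> frame W s s''"
  by (simp add: frame_def)

lemma frame_mono: "frame W s s' \<Longrightarrow> W \<subseteq> W' \<Longrightarrow> frame W' s s'"
  by (auto simp: frame_def)

lemma exec_frame: "exec \<Lambda> c s t U s' \<Longrightarrow> frame (writes c) s s'"
proof (induction rule: exec.induct)
  case (exec_Basic i s)
  then show ?case by (cases i) (auto simp: frame_def)
qed (auto simp: frame_refl elim: frame_mono intro: frame_trans)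

lemma run_frame: "run \<Lambda> V c s T Q \<Longrightarrow> run \<Lambda> V c s T (\<lambda>s'. Q s' \<and> frame (writes c) s s')"
  unfolding run_def using exec_frame by blast

lemma frame_ireg: "frame W s s' \<Longrightarrow> IVar r \<notin> W \<Longrightarrow> ireg s' r = ireg s r"
  and frame_rreg: "frame W s s' \<Longrightarrow> RVar x \<notin> W \<Longrightarrow> rreg s' x = rreg s x"
  and frame_iarr: "frame W s s' \<Longrightarrow> IArr A \<notin> W \<Longrightarrow> iarr s' A = iarr s A"
  and frame_rarr: "frame W s s' \<Longrightarrow> RArr A \<notin> W \<Longrightarrow> rarr s' A = rarr s A"
  by (auto simp: frame_def)

lemmas frameD = frame_ireg frame_rreg frame_iarr frame_rarr

text \<open>\<open>\<mu>\<close> bounds the number of rounds; each costs \<open>T\<close> and a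
  test, and the failing test adds \<open>1\<close>. The body may assume the frame relative to the
  state before the loop, so invariants only need to mention what the loop changes.\<close>

lemma run_While:
  assumes "I s" and b: "test_cells b \<subseteq> V"
    and body: "\<And>s'. \<lbrakk>I s'; frame (writes c) s s'; holds b s'\<rbrakk> \<Longrightarrow>
      run \<Lambda> V c s' T (\<lambda>s''. I s'' \<and> (\<mu> s'' :: nat) < \<mu> s')"
  shows "run \<Lambda> V (While b c) s (1 + \<mu> s * (1 + T))
    (\<lambda>s'. I s' \<and> \<not> holds b s' \<and> frame (writes c) s s')"
proof -
  have "run \<Lambda> V (While b c) s' (1 + \<mu> s' * (1 + T))
    (\<lambda>s''. I s'' \<and> \<not> holds b s'' \<and> frame (writes c) s s'')"
    if "I s'" "frame (writes c) s s'" for s'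
    using that
  proof (induction "\<mu> s'" arbitrary: s' rule: less_induct)
    case less
    show ?case
    proof (cases "holds b s'")
      case False
      then show ?thesis
        unfolding run_def using less.prems b exec_WhileF[of b s' \<Lambda> c] by fastforce
    next
      case True
      obtain t U s2 where 1: "exec \<Lambda> c s' t U s2" "t \<le> T" "U \<subseteq> V" "I s2" "\<mu> s2 < \<mu> s'"
        using body[OF less.prems True] by (auto simp: run_def)
      have "frame (writes c) s s2"
        using less.prems exec_frame[OF 1(1)] frame_trans by blast
      then obtain t' U' s3 where 2: "exec \<Lambda> (While b c) s2 t' U' s3" "t' \<le> 1 + \<mu> s2 * (1 + T)"
        "U' \<subseteq> V" "I s3" "\<not> holds b s3" "frame (writes c) s s3"
        using less.hyps[OF 1(5,4)] by (auto simp: run_def)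
      have "Suc (\<mu> s2) * (1 + T) \<le> \<mu> s' * (1 + T)"
        using 1(5) by (intro mult_le_mono1) simp
      then have "1 + t + t' \<le> 1 + \<mu> s' * (1 + T)"
        using 1(2) 2(2) by simp
      then show ?thesis
        unfolding run_def using exec_WhileT[OF True 1(1) 2(1)] 1(3) 2 b by blast
    qed
  qed
  then show ?thesis using assms(1) frame_refl by blast
qed

lemma shift_int: "drop_bit a (push_bit b (int x)) = int (x * 2 ^ b div 2 ^ a)"
  by (simp add: drop_bit_eq_div push_bit_eq_mult zdiv_int)

lemma run_block:
  "wp \<Lambda> V c Q s \<Longrightarrow> run_time c \<le> T \<Longrightarrow> run \<Lambda> V c s T (\<lambda>s'. Q s' \<and> frame (writes c) s s')"
  by (rule run_frame[OF run_mono[OF run_wp]])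

section \<open>The program\<close>

notation Seq (infixr ";;" 60)

text \<open>Integer registers: \<open>0\<close> holds \<open>n\<close>; \<open>2\<close>, \<open>3\<close>, \<open>30\<close> the constants \<open>0\<close>, \<open>-1\<close>, \<open>1\<close>; \<open>4\<close>, \<open>5\<close>, \<open>29\<close> the
  numbers \<open>n + 1\<close>, \<open>-(n + 1)\<close>, \<open>-(n + 1)\<^sup>2\<close>; \<open>10\<close> the level \<open>j\<close>; \<open>11\<close> and \<open>12\<close> the lengths at levels
  \<open>j\<close> and \<open>j + 1\<close>; \<open>16\<close> and \<open>17\<close> the configuration \<open>r\<close>, \<open>m\<close>; \<open>23\<close> the number of codewords that end at
  level \<open>j\<close>; \<open>26\<close> and \<open>27\<close> the next free node and the number of symbols done. Integer array \<open>2\<close> holds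
  the elements of \<open>\<Lambda>\<close>; the table of values is real array \<open>1\<close>, that of choices is integer array
  \<open>3\<close>. Integers can be neither subtracted nor multiplied, which is why registers \<open>14\<close>, \<open>15\<close>, \<open>21\<close> keep
  the offsets of the current table rows and why the descent from a level to the next shifts by
  the two lengths separately.\<close>

abbreviation skip :: com where
  "skip \<equiv> Basic (ICopy 22 22)"

text \<open>Products arise by repeated addition. Register \<open>6\<close> grows by
  \<open>n + 1\<close> up to the size \<open>(n + 1) ^ 2\<close> of a layer. Register
  \<open>29\<close> runs through negated squares: \<open>5\<close> is added before and after its
  decrement, in total \<open>-(2 * k + 3)\<close> in round \<open>k\<close>, counted from
  \<open>0\<close>. Register \<open>7\<close> counts the nonzero lengths and ends as
  \<open>K\<close>.\<close>

definition read_body :: com where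
  "read_body =
     Basic (IAdd 8 8 30) ;;
     Basic (ReadNext 9) ;;
     Basic (IStore 2 8 9) ;;
     Basic (IAdd 6 6 4) ;;
     Basic (IAdd 29 29 5) ;;
     Basic (IAdd 5 5 3) ;;
     Basic (IAdd 29 29 5) ;;
     Cond (ILess 2 9) (Basic (IAdd 7 7 30)) skip"

text \<open>The last block forms \<open>- B = - lam K - 1\<close> in real register \<open>4\<close>
  with the constant \<open>-1\<close> used as factor and as summand, and lets register
  \<open>15\<close> point to layer \<open>1\<close>.\<close>

definition read_input :: com where
  "read_input =
     (Basic (IConst 30 1) ;;
      Basic (IConst 3 (-1)) ;;
      Basic (IAdd 4 0 30) ;;
      Basic (ICopy 6 4) ;;
      Basic (ICopy 5 3) ;;
      Basic (ICopy 29 3) ;;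
      Basic (RConst 5 (-1))) ;;
     While (ILess 8 0) read_body ;;
     (Basic (ILoad 9 2 7) ;;
      Basic (ROfInt 7 9) ;;
      Basic (RMul 7 7 5) ;;
      Basic (RAdd 4 7 5) ;;
      Basic (ICopy 10 7) ;;
      Basic (ICopy 15 6))"

definition choice_body :: com where
  "choice_body =
     Basic (IShl 22 19 12) ;;
     Basic (IShr 22 22 11) ;;
     Cond (ILess 20 22) (Basic (ICopy 22 20)) skip ;;
     Basic (IAdd 22 22 21) ;;
     Basic (RLoad 7 1 22) ;;
     Cond (RLess 7 2) (Basic (RCopy 2 7) ;; Basic (ICopy 23 18)) (skip ;; skip) ;;
     Basic (IAdd 18 18 30) ;;
     Basic (IAdd 19 19 3) ;;
     Basic (IAdd 20 20 3) ;;
     Basic (IAdd 21 21 5)"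

definition cell_body :: com where
  "cell_body =
     (Basic (RConst 2 0) ;;
      Basic (IConst 23 0)) ;;
     Cond (ILeq 16 17)
       (Basic (RCopy 2 4) ;; Basic (ICopy 23 16))
       ((Basic (ICopy 19 17) ;;
         Basic (ICopy 20 16) ;;
         Basic (ICopy 21 14) ;;
         Basic (IConst 18 0)) ;;
        While (ILess 2 19) choice_body) ;;
     (Basic (RAdd 3 8 2) ;;
      Basic (IAdd 25 15 17) ;;
      Basic (RStore 1 25 3) ;;
      Basic (IStore 3 25 23) ;;
      Basic (IAdd 17 17 30))"

definition row_body :: com where
  "row_body =
     (Basic (IAdd 16 16 30) ;;
      Basic (IAdd 14 14 4) ;;
      Basic (IAdd 15 15 4) ;;
      Basic (RLoad 7 0 24) ;;
      Basic (RAdd 0 0 7) ;;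
      Basic (IAdd 24 24 3) ;;
      Basic (RMul 8 1 0) ;;
      Basic (IConst 17 0)) ;;
     While (ILeq 17 16) cell_body"

definition level_body :: com where
  "level_body =
     (Basic (IAdd 28 10 30) ;;
      Basic (ILoad 12 2 28) ;;
      Basic (ILoad 11 2 10) ;;
      Basic (IAdd 10 10 3) ;;
      Basic (ILoad 13 2 10) ;;
      Basic (ROfInt 1 13) ;;
      Basic (RMul 1 1 5) ;;
      Basic (ROfInt 7 11) ;;
      Basic (RAdd 1 7 1) ;;
      Basic (RConst 0 0) ;;
      Basic (ICopy 24 0) ;;
      Basic (IConst 16 0)) ;;
     While (ILess 16 0) row_body ;;
     (Basic (IAdd 14 14 4) ;;
      Basic (IAdd 15 15 4))"

definition assign_body :: com where
  "assign_body =
     Basic (IAdd 27 27 30) ;;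
     Basic (IStore 0 27 11) ;;
     Basic (IStore 1 27 26) ;;
     Basic (IAdd 26 26 30) ;;
     Basic (IAdd 16 16 3) ;;
     Basic (IAdd 17 17 3) ;;
     Basic (IAdd 15 15 5) ;;
     Basic (IAdd 23 23 3)"

text \<open>The last instruction moves back by a whole layer, as \<open>29\<close> is the negated
  layer size; the moves between rows are made in \<open>assign_body\<close>, one per symbol.\<close>

definition trace_body :: com where
  "trace_body =
     (Basic (IAdd 25 15 17) ;;
      Basic (ILoad 23 3 25)) ;;
     While (ILess 2 23) assign_body ;;
     (Basic (IAdd 10 10 30) ;;
      Basic (ILoad 12 2 10) ;;
      Basic (IShl 17 17 12) ;;
      Basic (IShr 17 17 11) ;;
      Cond (ILess 16 17) (Basic (ICopy 17 16)) skip ;;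
      Basic (IShl 26 26 12) ;;
      Basic (IShr 26 26 11) ;;
      Basic (ICopy 11 12) ;;
      Basic (IAdd 15 15 29))"

definition trace_init :: com where
  "trace_init =
     Basic (IAdd 15 15 5) ;;
     Basic (ICopy 10 30) ;;
     Basic (ILoad 11 2 10) ;;
     Basic (IShl 17 30 11) ;;
     Cond (ILess 0 17) (Basic (ICopy 17 0)) skip ;;
     Basic (ICopy 16 0)"

definition program :: com where
  "program =
     read_input ;;
     While (ILess 2 10) level_body ;;
     trace_init ;;
     While (ILess 2 16) trace_body"

section \<open>Correctness and complexity of the program\<close>

text \<open>A box around everything that is touched, with one bound \<open>N\<close> for all arrays.
  It is downward closed in each array, so charging for lower cells adds nothing.\<close>

definition cells :: "nat \<Rightarrow> cell set" where
  "cells N = IReg ` {..<31} \<union> RReg ` {..<9} \<union>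
     {ICell A k | A k. A < 4 \<and> k < N} \<union> {RCell A k | A k. A < 2 \<and> k < N}"

lemma in_cells [simp]:
  "IReg r \<in> cells N \<longleftrightarrow> r < 31"
  "RReg x \<in> cells N \<longleftrightarrow> x < 9"
  "ICell A k \<in> cells N \<longleftrightarrow> A < 4 \<and> k < N"
  "RCell A k \<in> cells N \<longleftrightarrow> A < 2 \<and> k < N"
  by (auto simp: cells_def)

context reserved_instance
begin

text \<open>The part of the state that is constant once the input is read. Its preservation by a
  piece of code is a disjointness check against \<open>env_vars\<close>.\<close>

definition env :: "state \<Rightarrow> bool" where
  "env s \<longleftrightarrow> ireg s 0 = int n \<and> ireg s 2 = 0 \<and> ireg s 3 = - 1 \<and> ireg s 30 = 1 \<and>
     ireg s 4 = int n + 1 \<and> ireg s 5 = - (int n + 1) \<and> ireg s 29 = - ((int n + 1) * (int n + 1)) \<and>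
     (\<forall>k. iarr s 2 k = int (lam k)) \<and> (\<forall>k\<in>{1..n}. rarr s 0 k = p k) \<and>
     rreg s 4 = - B \<and> rreg s 5 = - 1"

definition env_vars :: "var set" where
  "env_vars = {IVar 0, IVar 2, IVar 3, IVar 30, IVar 4, IVar 5, IVar 29, IArr 2, RArr 0, RVar 4, RVar 5}"

lemma env_frame: "\<lbrakk>frame W s s'; env s; W \<inter> env_vars = {}\<rbrakk> \<Longrightarrow> env s'"
  unfolding env_def env_vars_def frame_def by auto

section \<open>Addresses in the table\<close>

definition idx :: "nat \<Rightarrow> nat \<Rightarrow> nat \<Rightarrow> nat" where
  "idx d r m = (d * (n + 1) + r) * (n + 1) + m"

definition table_size :: nat where
  "table_size = (K + 1) * (n + 1) * (n + 1)"

lemma idx_less: "\<lbrakk>d \<le> K; r \<le> n; m \<le> n\<rbrakk> \<Longrightarrow> idx d r m < table_size"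
proof -
  assume a: "d \<le> K" "r \<le> n" "m \<le> n"
  have "d * (n + 1) \<le> K * (n + 1)" using a by (intro mult_le_mono1)
  then have "d * (n + 1) + r + 1 \<le> (K + 1) * (n + 1)" using a by simp
  then have "(d * (n + 1) + r + 1) * (n + 1) \<le> table_size" unfolding table_size_def by (intro mult_le_mono1)
  then show ?thesis using a by (simp add: idx_def)
qed

text \<open>\<open>r\<close> and \<open>m\<close> are digits to the base \<open>n + 1\<close>,
  recovered by division with remainder; hence writing one entry leaves the others intact.\<close>

lemma idx_inj:
  assumes "idx d r m = idx d' r' m'" "r \<le> n" "r' \<le> n" "m \<le> n" "m' \<le> n"
  shows "d = d' \<and> r = r' \<and> m = m'"
proof -
  have digits: "(a * (n + 1) + b) mod (n + 1) = b" "(a * (n + 1) + b) div (n + 1) = a" if "b \<le> n" for a b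
    using that by (simp_all only: mod_mult_self3 div_mult_self3 mod_less div_less less_Suc_eq_le
        flip: Suc_eq_plus1)
  show ?thesis using assms digits unfolding idx_def by metis
qed

lemma idx_add: "idx d r 0 + m = idx d r m"
  by (simp add: idx_def)

lemma int_idx_Suc: "int (idx d (Suc r) 0) = int (idx d r 0) + (int n + 1)"
  by (simp add: idx_def algebra_simps)

text \<open>The recorded choice is claimed only for a negative minimum: otherwise the minimum is the
  base \<open>0\<close> of \<open>running_min\<close>, which need not be attained by a
  candidate.\<close>

lemma run_choice_loop:
  assumes "env s" and j: "j \<le> K" and "r \<le> n" "m < r"
    and s0: "ireg s 11 = int (lam j)" "ireg s 12 = int (lam (Suc j))" "ireg s 19 = int m"
      "ireg s 20 = int r" "ireg s 21 = int (idx (K - j) r 0)" "ireg s 18 = 0" "rreg s 2 = 0"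
    and tbl: "\<And>r' m'. \<lbrakk>1 \<le> r'; r' \<le> n; m' \<le> r'\<rbrakk> \<Longrightarrow> rarr s 1 (idx (K - j) r' m') = val (K - j) r' m'"
  defines "f \<equiv> \<lambda>k. val (K - j) (r - k) (slots j (r - k) (m - k))"
  shows "run \<Lambda> (cells table_size) (While (ILess 2 19) choice_body) s (1 + n * 15)
     (\<lambda>s'. rreg s' 2 = running_min f m \<and>
        (running_min f m < 0 \<longrightarrow> (\<exists>c<m. ireg s' 23 = int c \<and> running_min f m = f c)))"
proof -
  define I where "I s' \<longleftrightarrow> (\<exists>k\<le>m. ireg s' 18 = int k \<and> ireg s' 19 = int m - int k \<and>
    ireg s' 20 = int r - int k \<and> ireg s' 21 = int (idx (K - j) (r - k) 0) \<and>
    rreg s' 2 = running_min f k \<and>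
    (running_min f k < 0 \<longrightarrow> (\<exists>c<k. ireg s' 23 = int c \<and> running_min f k = f c)))" for s' :: state
  have "I s" unfolding I_def using s0 by (intro exI[of _ 0]) simp
  then have "run \<Lambda> (cells table_size) (While (ILess 2 19) choice_body) s (1 + nat (ireg s 19) * (1 + 14))
    (\<lambda>s'. I s' \<and> \<not> holds (ILess 2 19) s' \<and> frame (writes choice_body) s s')"
  proof (rule run_While)
    fix s' assume "I s'" and fr: "frame (writes choice_body) s s'" and h: "holds (ILess 2 19) s'"
    have e: "env s'" using fr \<open>env s\<close> by (rule env_frame) (simp add: choice_body_def env_vars_def)
    have c: "ireg s' 11 = int (lam j)" "ireg s' 12 = int (lam (Suc j))" "rarr s' 1 = rarr s 1"
      using fr s0 by (simp_all add: frameD choice_body_def)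
    from \<open>I s'\<close> obtain k where k: "k \<le> m" "ireg s' 18 = int k" "ireg s' 19 = int m - int k"
      "ireg s' 20 = int r - int k" "ireg s' 21 = int (idx (K - j) (r - k) 0)"
      "rreg s' 2 = running_min f k"
      "running_min f k < 0 \<Longrightarrow> (\<exists>c<k. ireg s' 23 = int c \<and> running_min f k = f c)"
      unfolding I_def by blast
    have "k < m" using h e k by (simp add: env_def)
    then obtain a where a: "m = k + a" "0 < a" using less_imp_add_positive by blast
    obtain b where b: "r = k + b" "a < b"
      by (rule that[of "r - k"]) (use a \<open>m < r\<close> in auto)
    have f: "rarr s' 1 (idx (K - j) b (slots j b a)) = f k"
      unfolding f_def c using tbl slots_le a b \<open>r \<le> n\<close> by simp
    have lt: "idx (K - j) b (slots j b a) < table_size"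
      using slots_le[of j b a] b \<open>r \<le> n\<close> by (intro idx_less) auto
    have idx': "int (idx (K - j) b 0) - (int n + 1) = int (idx (K - j) (b - 1) 0)"
      using int_idx_Suc[of "K - j" "b - 1"] b by simp
    have ad: "nat (int x + int (idx (K - j) b 0)) = idx (K - j) b x" for x
      by (metis add.commute idx_add nat_int of_nat_add)
    define x where "x = a * 2 ^ lam (Suc j) div 2 ^ lam j"
    have sl: "slots j b a = (if b < x then b else x)"
      by (simp add: slots_def x_def)
    have regs: "ireg s' 2 = 0" "ireg s' 3 = - 1" "ireg s' 30 = 1" "ireg s' 5 = - (int n + 1)"
      "ireg s' 19 = int a" "ireg s' 20 = int b" "ireg s' 21 = int (idx (K - j) b 0)"
      using e k a b by (simp_all add: env_def)
    have I': "I s''" if "ireg s'' 18 = int k + 1" "ireg s'' 19 = int a - 1"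
       "ireg s'' 20 = int b - 1" "ireg s'' 21 = int (idx (K - j) b 0) - (int n + 1)"
       "rreg s'' 2 = min (running_min f k) (f k)"
       "ireg s'' 23 = (if f k < running_min f k then int k else ireg s' 23)" for s''
    proof -
      have "\<exists>c<Suc k. ireg s'' 23 = int c \<and> running_min f (Suc k) = f c" if neg: "running_min f (Suc k) < 0"
      proof (cases "f k < running_min f k")
        case True
        then show ?thesis using \<open>ireg s'' 23 = _\<close> by (intro exI[of _ k]) simp
      next
        case False
        then have eq: "running_min f (Suc k) = running_min f k" by simp
        then obtain c where "c < k" "ireg s' 23 = int c" "running_min f k = f c"
          using k(7) neg by metis
        then show ?thesis using False eq \<open>ireg s'' 23 = _\<close> by (intro exI[of _ c]) simp
      qed
      then show ?thesis unfolding I_def using that a b idx' by (intro exI[of _ "Suc k"]) auto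
    qed
    have "wp \<Lambda> (cells table_size) choice_body (\<lambda>s''. I s'' \<and> nat (ireg s'' 19) < nat (ireg s' 19)) s'"
      using lt f \<open>0 < a\<close> unfolding choice_body_def sl
      by (cases "b < x"; cases "f k < running_min f k")
        (auto simp: c(1,2) regs k(2,6) shift_int x_def[symmetric] ad intro!: I')
    from run_block[OF this]
    show "run \<Lambda> (cells table_size) choice_body s' 14 (\<lambda>s''. I s'' \<and> nat (ireg s'' 19) < nat (ireg s' 19))"
      by (rule run_mono) (auto simp: choice_body_def)
  qed simp
  then show ?thesis
  proof (rule run_mono)
    show "1 + nat (ireg s 19) * (1 + 14) \<le> 1 + n * 15" using s0 assms by simp
  next
    fix s' assume s': "I s' \<and> \<not> holds (ILess 2 19) s' \<and> frame (writes choice_body) s s'"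
    have "env s'"
      by (rule env_frame[OF _ \<open>env s\<close>]) (use s' in \<open>auto simp: choice_body_def env_vars_def\<close>)
    then have "ireg s' 2 = 0" by (simp add: env_def)
    then show "rreg s' 2 = running_min f m \<and>
        (running_min f m < 0 \<longrightarrow> (\<exists>c<m. ireg s' 23 = int c \<and> running_min f m = f c))"
      using s' unfolding I_def by auto
  qed
qed

text \<open>Layer \<open>0\<close> is never written: its initial zeros are the values of \<open>val 0\<close>.\<close>

definition cell_ok :: "state \<Rightarrow> nat \<Rightarrow> nat \<Rightarrow> nat \<Rightarrow> bool" where
  "cell_ok s d r m \<longleftrightarrow> rarr s 1 (idx d r m) = val d r m \<and>
     (1 \<le> d \<longrightarrow> val d r m < 0 \<longrightarrow>
       (\<exists>c. iarr s 3 (idx d r m) = int c \<and> good_choice d r m c))"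

text \<open>The entries before \<open>(D, R, M)\<close> in lexicographic order. Those with
  \<open>1 \<le> r\<close> and \<open>m \<le> r\<close> suffice, since \<open>slots\<close> is
  capped and \<open>s < m < r\<close> leaves a symbol to be placed.\<close>

definition filled :: "state \<Rightarrow> nat \<Rightarrow> nat \<Rightarrow> nat \<Rightarrow> bool" where
  "filled s D R M \<longleftrightarrow> (\<forall>d r m. 1 \<le> r \<longrightarrow> r \<le> n \<longrightarrow> m \<le> r \<longrightarrow>
     d < D \<or> d = D \<and> (r < R \<or> r = R \<and> m < M) \<longrightarrow> cell_ok s d r m)"

lemma filled_cong:
  "\<lbrakk>filled s D R M; rarr s' 1 = rarr s 1; iarr s' 3 = iarr s 3\<rbrakk> \<Longrightarrow> filled s' D R M"
  by (simp add: filled_def cell_ok_def)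

lemma filled_next_row: "filled s D R (Suc R) \<Longrightarrow> filled s D (Suc R) 0"
  unfolding filled_def by (metis le_less_Suc_eq less_Suc_eq not_less_zero not_less less_Suc_eq_le)

lemma filled_next_layer: "filled s D (Suc n) 0 \<Longrightarrow> filled s (Suc D) 1 0"
  unfolding filled_def by (metis less_Suc_eq less_Suc_eq_le not_less_zero less_one not_less)

lemma filled_write:
  assumes "filled s D R M" "R \<le> n" "M \<le> R"
    and "rarr s' 1 = (rarr s 1)(idx D R M := val D R M)" "iarr s' 3 = (iarr s 3)(idx D R M := x)"
    and "1 \<le> D \<Longrightarrow> val D R M < 0 \<Longrightarrow> \<exists>c. x = int c \<and> good_choice D R M c"
  shows "filled s' D R (Suc M)"
  unfolding filled_def
proof (intro allI impI)
  fix d r m assume a: "1 \<le> r" "r \<le> n" "m \<le> r" "d < D \<or> d = D \<and> (r < R \<or> r = R \<and> m < Suc M)"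
  show "cell_ok s' d r m"
  proof (cases "d = D \<and> r = R \<and> m = M")
    case True
    then show ?thesis using assms(4-6) by (simp add: cell_ok_def)
  next
    case False
    then have "idx d r m \<noteq> idx D R M" using idx_inj[of d r m D R M] a assms(2,3) by auto
    moreover have "cell_ok s d r m"
      using assms(1) a False unfolding filled_def by (auto simp: less_Suc_eq)
    ultimately show ?thesis using assms(4,5) by (simp add: cell_ok_def)
  qed
qed

lemma run_cell:
  assumes "env s" and j: "1 \<le> j" "j \<le> K" and "1 \<le> r" "r \<le> n" "m \<le> r"
    and s0: "ireg s 11 = int (lam j)" "ireg s 12 = int (lam (Suc j))" "ireg s 16 = int r"
      "ireg s 17 = int m" "ireg s 14 = int (idx (K - j) r 0)" "ireg s 15 = int (idx (Suc (K - j)) r 0)"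
      "rreg s 8 = (real (lam j) - real (lam (j - 1))) * tail r"
    and fl: "filled s (Suc (K - j)) r m"
  shows "run \<Lambda> (cells table_size) cell_body s (13 + n * 15)
     (\<lambda>s'. ireg s' 17 = int (Suc m) \<and> filled s' (Suc (K - j)) r (Suc m))"
proof -
  let ?D = "Suc (K - j)"
  define f where "f k = val (K - j) (r - k) (slots j (r - k) (m - k))" for k
  have Kj: "K - (K - j) = j" "K - Suc (K - j) = j - 1" "K + 1 - ?D = j" using j by auto
  have val_eq: "val ?D r m = rreg s 8 + (if r \<le> m then - B else running_min f m)"
    unfolding val.simps f_def s0 Kj by simp
  have good_eq: "good_choice ?D r m c \<longleftrightarrow> (if r \<le> m then c = r else c < m \<and> running_min f m = f c)" for c
    unfolding good_choice_def Kj f_def by simp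
  have w: "0 \<le> rreg s 8" unfolding s0 using lam_le[of "j - 1" j] j tail_nonneg by simp
  define Q where "Q s' \<longleftrightarrow> rreg s' 2 = (if r \<le> m then - B else running_min f m) \<and>
      (rreg s' 2 < 0 \<longrightarrow> (\<exists>c. ireg s' 23 = int c \<and> good_choice ?D r m c)) \<and>
      frame (writes cell_body - {RArr 1, IArr 3, IVar 17}) s s'" for s' :: state
  note fsimps = choice_body_def cell_body_def
  have 1: "run \<Lambda> (cells table_size) (Basic (RConst 2 0) ;; Basic (IConst 23 0)) s 2
    (\<lambda>s'. rreg s' 2 = 0 \<and> frame {RVar 2, IVar 23} s s')"
    using run_block[of \<Lambda> "cells table_size" "Basic (RConst 2 0) ;; Basic (IConst 23 0)"
        "\<lambda>s'. rreg s' 2 = 0" s 2] by (simp add: insert_commute)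
  have 2: "run \<Lambda> (cells table_size)
     (Cond (ILeq 16 17)
       (Basic (RCopy 2 4) ;; Basic (ICopy 23 16))
       ((Basic (ICopy 19 17) ;;
         Basic (ICopy 20 16) ;;
         Basic (ICopy 21 14) ;;
         Basic (IConst 18 0)) ;;
        While (ILess 2 19) choice_body)) s1 (1 + (4 + (1 + n * 15))) Q"
    if s1: "rreg s1 2 = 0" "frame {RVar 2, IVar 23} s s1" for s1
  proof (rule run_Cond)
    have e: "env s1" using s1(2) \<open>env s\<close> by (rule env_frame) (simp add: env_vars_def)
    have c: "ireg s1 11 = int (lam j)" "ireg s1 12 = int (lam (Suc j))" "ireg s1 16 = int r"
      "ireg s1 17 = int m" "ireg s1 14 = int (idx (K - j) r 0)"
      "rarr s1 = rarr s"
      using s1 s0 by (auto simp: frame_def)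
    show "test_cells (ILeq 16 17) \<subseteq> cells table_size" by simp
    { assume h: "holds (ILeq 16 17) s1"
      then have rm: "r \<le> m" using c by simp
      have "wp \<Lambda> (cells table_size) (Basic (RCopy 2 4) ;; Basic (ICopy 23 16)) Q s1"
        using e s1(2) rm unfolding Q_def good_eq
        by (auto simp: c env_def frame_def fsimps)
      from run_block[OF this, of 2]
      show "run \<Lambda> (cells table_size) (Basic (RCopy 2 4) ;; Basic (ICopy 23 16)) s1 (4 + (1 + n * 15)) Q"
        by (rule run_mono) auto }
    { assume h: "\<not> holds (ILeq 16 17) s1"
      then have rm: "m < r" using c by simp
      show "run \<Lambda> (cells table_size) ((Basic (ICopy 19 17) ;;
         Basic (ICopy 20 16) ;;
         Basic (ICopy 21 14) ;;
         Basic (IConst 18 0)) ;;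
        While (ILess 2 19) choice_body) s1 (4 + (1 + n * 15)) Q"
      proof (rule run_Seq)
        let ?c = "Basic (ICopy 19 17) ;; Basic (ICopy 20 16) ;; Basic (ICopy 21 14) ;; Basic (IConst 18 0)"
        have "wp \<Lambda> (cells table_size) ?c (\<lambda>s'. ireg s' 19 = int m \<and> ireg s' 20 = int r \<and>
           ireg s' 21 = int (idx (K - j) r 0) \<and> ireg s' 18 = 0) s1"
          by (simp add: c)
        from run_block[OF this]
        show "run \<Lambda> (cells table_size) ?c s1 4 (\<lambda>s'. (ireg s' 19 = int m \<and> ireg s' 20 = int r \<and>
           ireg s' 21 = int (idx (K - j) r 0) \<and> ireg s' 18 = 0) \<and> frame (writes ?c) s1 s')"
          by simp
      next
        let ?c = "Basic (ICopy 19 17) ;; Basic (ICopy 20 16) ;; Basic (ICopy 21 14) ;; Basic (IConst 18 0)"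
        fix s2 assume s2: "(ireg s2 19 = int m \<and> ireg s2 20 = int r \<and>
           ireg s2 21 = int (idx (K - j) r 0) \<and> ireg s2 18 = 0) \<and> frame (writes ?c) s1 s2"
        have e2: "env s2" by (rule env_frame[OF conjunct2[OF s2] e]) (simp add: env_vars_def)
        have r2: "rarr s2 1 = rarr s 1" "rreg s2 2 = 0" "ireg s2 11 = int (lam j)"
          "ireg s2 12 = int (lam (Suc j))"
          using s2 c s1 by (auto simp: frame_def)
        have tbl: "rarr s2 1 (idx (K - j) r' m') = val (K - j) r' m'"
          if "1 \<le> r'" "r' \<le> n" "m' \<le> r'" for r' m'
          unfolding r2 using fl that unfolding filled_def cell_ok_def by simp
        have "run \<Lambda> (cells table_size) (While (ILess 2 19) choice_body) s2 (1 + n * 15)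
          (\<lambda>s'. rreg s' 2 = running_min f m \<and>
            (running_min f m < 0 \<longrightarrow> (\<exists>c<m. ireg s' 23 = int c \<and> running_min f m = f c)))"
          unfolding f_def
          by (rule run_choice_loop) (use e2 j rm \<open>r \<le> n\<close> s2 r2 tbl in auto)
        from run_frame[OF this]
        show "run \<Lambda> (cells table_size) (While (ILess 2 19) choice_body) s2 (1 + n * 15) Q"
        proof (rule run_mono)
          fix s3 assume s3: "(rreg s3 2 = running_min f m \<and>
            (running_min f m < 0 \<longrightarrow> (\<exists>c<m. ireg s3 23 = int c \<and> running_min f m = f c))) \<and>
            frame (writes (While (ILess 2 19) choice_body)) s2 s3"
          let ?W = "writes cell_body - {RArr 1, IArr 3, IVar 17}"
          have "frame ?W s s1" by (rule frame_mono[OF s1(2)]) (simp add: fsimps)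
          moreover have "frame ?W s1 s2" by (rule frame_mono[OF conjunct2[OF s2]]) (simp add: fsimps)
          moreover have "frame ?W s2 s3" by (rule frame_mono[OF conjunct2[OF s3]]) (simp add: fsimps)
          ultimately have "frame ?W s s3" by (blast intro: frame_trans)
          then show "Q s3" using s3 rm unfolding Q_def good_eq by auto
        qed simp
      qed }
  qed
  have 3: "run \<Lambda> (cells table_size) (Basic (RAdd 3 8 2) ;;
      Basic (IAdd 25 15 17) ;;
      Basic (RStore 1 25 3) ;;
      Basic (IStore 3 25 23) ;;
      Basic (IAdd 17 17 30)) s2 5
      (\<lambda>s'. ireg s' 17 = int (Suc m) \<and> filled s' ?D r (Suc m))" if "Q s2" for s2
  proof -
    have fr: "frame (writes cell_body - {RArr 1, IArr 3, IVar 17}) s s2" using that by (simp add: Q_def)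
    have e: "env s2" using fr \<open>env s\<close> by (rule env_frame) (auto simp: fsimps env_vars_def)
    have c: "rreg s2 8 = rreg s 8" "ireg s2 15 = int (idx ?D r 0)" "ireg s2 17 = int m"
      "rarr s2 1 = rarr s 1" "iarr s2 3 = iarr s 3"
      using fr s0 by (simp_all add: frameD fsimps)
    have ad: "nat (int (idx ?D r 0) + int m) = idx ?D r m"
      by (metis idx_add nat_int of_nat_add)
    have lt: "idx ?D r m < table_size" using j \<open>r \<le> n\<close> \<open>m \<le> r\<close> by (intro idx_less) auto
    have v: "rreg s2 8 + rreg s2 2 = val ?D r m"
      using that unfolding Q_def val_eq c by simp
    have fl2: "filled s2 ?D r m" using filled_cong[OF fl] c by simp
    \<comment> \<open>The charge in real register \<open>8\<close> is nonnegative, so a negative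
      entry forces a negative minimum, for which the recorded choice is meaningful.\<close>
    have ch: "\<exists>c. ireg s2 23 = int c \<and> good_choice ?D r m c" if "val ?D r m < 0"
      using that v w \<open>Q s2\<close> unfolding Q_def c by auto
    have "wp \<Lambda> (cells table_size) (Basic (RAdd 3 8 2) ;;
      Basic (IAdd 25 15 17) ;;
      Basic (RStore 1 25 3) ;;
      Basic (IStore 3 25 23) ;;
      Basic (IAdd 17 17 30)) (\<lambda>s'. ireg s' 17 = int (Suc m) \<and> filled s' ?D r (Suc m)) s2"
      using e lt ch v unfolding env_def
      by (auto simp: c(2-5) ad intro!: filled_write[OF fl2, where x = "ireg s2 23"]
          \<open>r \<le> n\<close> \<open>m \<le> r\<close>)
    from run_block[OF this] show ?thesis by (rule run_mono) auto
  qed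
  have "run \<Lambda> (cells table_size) cell_body s (2 + ((1 + (4 + (1 + n * 15))) + 5))
     (\<lambda>s'. ireg s' 17 = int (Suc m) \<and> filled s' ?D r (Suc m))"
    unfolding cell_body_def
    by (rule run_Seq[OF 1], rule run_Seq[OF 2], blast, blast, rule 3)
  then show ?thesis by (rule run_mono) auto
qed

lemma run_row:
  assumes "env s" and j: "1 \<le> j" "j \<le> K" and "r < n"
    and s0: "ireg s 11 = int (lam j)" "ireg s 12 = int (lam (Suc j))" "ireg s 16 = int r"
      "ireg s 14 = int (idx (K - j) r 0)" "ireg s 15 = int (idx (Suc (K - j)) r 0)"
      "ireg s 24 = int n - int r"
      "rreg s 0 = tail r" "rreg s 1 = real (lam j) - real (lam (j - 1))"
    and fl: "filled s (Suc (K - j)) (Suc r) 0"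
  shows "run \<Lambda> (cells table_size) row_body s (9 + (n + 1) * (14 + n * 15))
     (\<lambda>s'. ireg s' 16 = int (Suc r) \<and> ireg s' 14 = int (idx (K - j) (Suc r) 0) \<and>
       ireg s' 15 = int (idx (Suc (K - j)) (Suc r) 0) \<and> ireg s' 24 = int n - int (Suc r) \<and>
       rreg s' 0 = tail (Suc r) \<and> filled s' (Suc (K - j)) (Suc (Suc r)) 0)"
proof -
  let ?D = "Suc (K - j)"
  define Q where "Q s' \<longleftrightarrow> ireg s' 16 = int (Suc r) \<and> ireg s' 14 = int (idx (K - j) (Suc r) 0) \<and>
       ireg s' 15 = int (idx ?D (Suc r) 0) \<and> ireg s' 24 = int n - int (Suc r) \<and>
       rreg s' 0 = tail (Suc r) \<and> rreg s' 8 = (real (lam j) - real (lam (j - 1))) * tail (Suc r)"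
    for s' :: state
  note fsimps = choice_body_def cell_body_def row_body_def
  let ?c = "Basic (IAdd 16 16 30) ;; Basic (IAdd 14 14 4) ;; Basic (IAdd 15 15 4) ;;
      Basic (RLoad 7 0 24) ;; Basic (RAdd 0 0 7) ;; Basic (IAdd 24 24 3) ;;
      Basic (RMul 8 1 0) ;; Basic (IConst 17 0)"
  have p: "rarr s 0 (nat (int n - int r)) = p (n - r)"
    using \<open>env s\<close> \<open>r < n\<close> by (simp add: env_def flip: of_nat_diff)
  have "n < table_size" using idx_less[of 0 0 n] by (simp add: idx_def)
  then have lt: "nat (int n - int r) < table_size" by linarith
  have "wp \<Lambda> (cells table_size) ?c (\<lambda>s'. Q s' \<and> ireg s' 17 = 0) s"
    using \<open>env s\<close> \<open>r < n\<close> p lt unfolding Q_def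
    by (simp add: env_def s0 int_idx_Suc tail_Suc add.commute del: One_nat_def)
  from run_block[OF this]
  have 1: "run \<Lambda> (cells table_size) ?c s 8 (\<lambda>s'. (Q s' \<and> ireg s' 17 = 0) \<and> frame (writes ?c) s s')"
    by simp
  have 2: "run \<Lambda> (cells table_size) (While (ILeq 17 16) cell_body) s1 (1 + (n + 1) * (14 + n * 15))
     (\<lambda>s'. Q s' \<and> filled s' ?D (Suc (Suc r)) 0)"
    if s1: "(Q s1 \<and> ireg s1 17 = 0) \<and> frame (writes ?c) s s1" for s1
  proof -
    have e1: "env s1" by (rule env_frame[OF _ \<open>env s\<close>]) (use s1 in \<open>auto simp: env_vars_def\<close>)
    define I where "I s' \<longleftrightarrow> (\<exists>m\<le>Suc (Suc r). ireg s' 17 = int m \<and> filled s' ?D (Suc r) m)" for s' :: state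
    define \<mu> where "\<mu> s' = nat (int r + 2 - ireg s' 17)" for s' :: state
    have fl1: "filled s1 ?D (Suc r) 0" using filled_cong[OF fl, of s1] s1 by (auto simp: frame_def)
    have "I s1" unfolding I_def using s1 fl1 by (intro exI[of _ 0]) auto
    then have "run \<Lambda> (cells table_size) (While (ILeq 17 16) cell_body) s1 (1 + \<mu> s1 * (1 + (13 + n * 15)))
      (\<lambda>s'. I s' \<and> \<not> holds (ILeq 17 16) s' \<and> frame (writes cell_body) s1 s')"
    proof (rule run_While)
      fix s2 assume "I s2" and fr: "frame (writes cell_body) s1 s2" and h: "holds (ILeq 17 16) s2"
      have e2: "env s2" using fr e1 by (rule env_frame) (simp add: fsimps env_vars_def)
      have "frame (writes row_body) s s2"
        by (rule frame_trans[OF frame_mono[of "writes ?c"] frame_mono[OF fr]]) (use s1 in \<open>auto simp: fsimps\<close>)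
      then have c: "ireg s2 11 = int (lam j)" "ireg s2 12 = int (lam (Suc j))"
        using s0 by (simp_all add: frameD fsimps)
      have c': "ireg s2 16 = int (Suc r)" "ireg s2 14 = int (idx (K - j) (Suc r) 0)"
        "ireg s2 15 = int (idx ?D (Suc r) 0)"
        "rreg s2 8 = (real (lam j) - real (lam (j - 1))) * tail (Suc r)"
        using s1 fr unfolding Q_def by (simp_all add: frameD fsimps)
      from \<open>I s2\<close> obtain m where m: "ireg s2 17 = int m" "filled s2 ?D (Suc r) m" "m \<le> Suc r"
        using h c' unfolding I_def by auto
      have "run \<Lambda> (cells table_size) cell_body s2 (13 + n * 15)
        (\<lambda>s'. ireg s' 17 = int (Suc m) \<and> filled s' ?D (Suc r) (Suc m))"
        by (rule run_cell) (use e2 j c c' m \<open>r < n\<close> in auto)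
      then show "run \<Lambda> (cells table_size) cell_body s2 (13 + n * 15) (\<lambda>s'. I s' \<and> \<mu> s' < \<mu> s2)"
        by (rule run_mono) (use m in \<open>auto simp: I_def \<mu>_def\<close>)
    qed simp
    then show ?thesis
    proof (rule run_mono)
      \<comment> \<open>Row \<open>r + 1\<close> has the \<open>r + 2\<close> entries with
        \<open>m\<close> from \<open>0\<close> to \<open>r + 1\<close>.\<close>
      have "\<mu> s1 = r + 2" using s1 by (simp add: \<mu>_def nat_add_distrib)
      then have "\<mu> s1 \<le> n + 1" using \<open>r < n\<close> by simp
      then have "\<mu> s1 * (1 + (13 + n * 15)) \<le> (n + 1) * (1 + (13 + n * 15))"
        by (rule mult_le_mono1)
      then show "1 + \<mu> s1 * (1 + (13 + n * 15)) \<le> 1 + (n + 1) * (14 + n * 15)" by simp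
    next
      fix s2 assume s2: "I s2 \<and> \<not> holds (ILeq 17 16) s2 \<and> frame (writes cell_body) s1 s2"
      then have fr: "frame (writes cell_body) s1 s2" by blast
      have "Q s2" using s1 fr unfolding Q_def by (simp add: frameD fsimps)
      moreover have "filled s2 ?D (Suc r) (Suc (Suc r))"
        using s2 \<open>Q s2\<close> unfolding I_def Q_def by (auto simp: le_Suc_eq)
      ultimately show "Q s2 \<and> filled s2 ?D (Suc (Suc r)) 0" using filled_next_row by blast
    qed
  qed
  have "run \<Lambda> (cells table_size) row_body s (8 + (1 + (n + 1) * (14 + n * 15)))
     (\<lambda>s'. Q s' \<and> filled s' ?D (Suc (Suc r)) 0)"
    unfolding row_body_def by (rule run_Seq[OF 1 2])
  then show ?thesis by (rule run_mono) (auto simp: Q_def)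
qed


text \<open>One row past the last is the start of the next layer, so the increment
  \<open>n + 1\<close> also changes layers.\<close>

lemma idx_wrap: "idx d (Suc n) 0 = idx (Suc d) 0 0"
  by (simp add: idx_def algebra_simps)

lemma lam_index: "i \<le> n + 1 \<Longrightarrow> i < table_size"
proof -
  assume "i \<le> n + 1"
  also have "n + 1 < (K + 1) * (n + 1)" using K_pos by simp
  also have "\<dots> \<le> table_size" by (simp add: table_size_def)
  finally show ?thesis .
qed

lemma run_level:
  assumes "env s" and j: "1 \<le> j" "j \<le> K"
    and s0: "ireg s 10 = int j" "ireg s 14 = int (idx (K - j) 0 0)" "ireg s 15 = int (idx (Suc (K - j)) 0 0)"
    and fl: "filled s (Suc (K - j)) 1 0"
  shows "run \<Lambda> (cells table_size) level_body s (15 + n * (10 + (n + 1) * (14 + n * 15)))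
     (\<lambda>s'. ireg s' 10 = int (j - 1) \<and> ireg s' 14 = int (idx (Suc (K - j)) 0 0) \<and>
       ireg s' 15 = int (idx (Suc (Suc (K - j))) 0 0) \<and> filled s' (Suc (Suc (K - j))) 1 0)"
proof -
  let ?D = "Suc (K - j)"
  note fsimps = choice_body_def cell_body_def row_body_def
  define Q where "Q s' \<longleftrightarrow> ireg s' 10 = int (j - 1) \<and> ireg s' 11 = int (lam j) \<and>
      ireg s' 12 = int (lam (Suc j)) \<and> rreg s' 1 = real (lam j) - real (lam (j - 1))" for s' :: state
  define R where "R r s' \<longleftrightarrow> ireg s' 16 = int r \<and> ireg s' 14 = int (idx (K - j) r 0) \<and>
      ireg s' 15 = int (idx ?D r 0) \<and> ireg s' 24 = int n - int r \<and>
      rreg s' 0 = tail r \<and> filled s' ?D (Suc r) 0" for r and s' :: state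
  let ?c = "Basic (IAdd 28 10 30) ;; Basic (ILoad 12 2 28) ;; Basic (ILoad 11 2 10) ;;
      Basic (IAdd 10 10 3) ;; Basic (ILoad 13 2 10) ;; Basic (ROfInt 1 13) ;; Basic (RMul 1 1 5) ;;
      Basic (ROfInt 7 11) ;; Basic (RAdd 1 7 1) ;; Basic (RConst 0 0) ;; Basic (ICopy 24 0) ;;
      Basic (IConst 16 0)"
  have b: "j < table_size" "Suc j < table_size" "j - 1 < table_size"
    using j K_le by (auto intro: lam_index)
  obtain i where i: "j = Suc i" using j by (cases j) auto
  have i2: "nat (2 + int i) = Suc (Suc i)" "nat (1 + int i) = Suc i" by auto
  have "wp \<Lambda> (cells table_size) ?c (\<lambda>s'. Q s' \<and>
      ireg s' 16 = 0 \<and> ireg s' 24 = int n \<and> rreg s' 0 = 0) s"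
    using \<open>env s\<close> b unfolding Q_def i
    by (auto simp: env_def s0 i i2)
  from run_block[OF this]
  have 1: "run \<Lambda> (cells table_size) ?c s 12 (\<lambda>s'. Q s' \<and> R 0 s' \<and> env s')"
  proof (rule run_mono)
    fix s' assume s': "(Q s' \<and> ireg s' 16 = 0 \<and> ireg s' 24 = int n \<and> rreg s' 0 = 0) \<and> frame (writes ?c) s s'"
    have "env s'" by (rule env_frame[OF conjunct2[OF s'] \<open>env s\<close>]) (simp add: env_vars_def)
    moreover have "filled s' ?D 1 0" using filled_cong[OF fl, of s'] s' by (auto simp: frame_def)
    moreover have "ireg s' 14 = ireg s 14" "ireg s' 15 = ireg s 15" using s' by (auto simp: frame_def)
    ultimately show "Q s' \<and> R 0 s' \<and> env s'" using s' s0 by (auto simp: R_def)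
  qed auto
  have 2: "run \<Lambda> (cells table_size) (While (ILess 16 0) row_body) s1
      (1 + n * (10 + (n + 1) * (14 + n * 15))) (\<lambda>s'. Q s' \<and> R n s' \<and> env s')"
    if s1: "Q s1 \<and> R 0 s1 \<and> env s1" for s1
  proof -
    define \<mu> where "\<mu> s' = nat (int n - ireg s' 16)" for s' :: state
    have "\<exists>r\<le>n. R r s1" using s1 by blast
    then have "run \<Lambda> (cells table_size) (While (ILess 16 0) row_body) s1
      (1 + \<mu> s1 * (1 + (9 + (n + 1) * (14 + n * 15))))
      (\<lambda>s'. (\<exists>r\<le>n. R r s') \<and> \<not> holds (ILess 16 0) s' \<and> frame (writes row_body) s1 s')"
    proof (rule run_While)
      fix s2 assume "\<exists>r\<le>n. R r s2" and fr: "frame (writes row_body) s1 s2" and h: "holds (ILess 16 0) s2"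
      have e2: "env s2" by (rule env_frame[OF fr]) (use s1 in \<open>auto simp: fsimps env_vars_def\<close>)
      have "Q s2" using s1 fr unfolding Q_def by (simp add: frameD fsimps)
      from \<open>\<exists>r\<le>n. R r s2\<close> obtain r where r: "R r s2" "r \<le> n" by blast
      then have "r < n" using h e2 by (simp add: R_def env_def)
      have "run \<Lambda> (cells table_size) row_body s2 (9 + (n + 1) * (14 + n * 15)) (\<lambda>s'. R (Suc r) s')"
        unfolding R_def by (rule run_row) (use e2 j \<open>r < n\<close> \<open>Q s2\<close> r in \<open>auto simp: Q_def R_def\<close>)
      then show "run \<Lambda> (cells table_size) row_body s2 (9 + (n + 1) * (14 + n * 15))
          (\<lambda>s'. (\<exists>r\<le>n. R r s') \<and> \<mu> s' < \<mu> s2)"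
      proof (rule run_mono)
        fix s' assume s': "R (Suc r) s'"
        then have "\<mu> s' < \<mu> s2" using r \<open>r < n\<close> unfolding R_def \<mu>_def by simp
        then show "(\<exists>r\<le>n. R r s') \<and> \<mu> s' < \<mu> s2" using s' \<open>r < n\<close> by (metis Suc_leI)
      qed simp
    qed simp
    then show ?thesis
    proof (rule run_mono)
      show "1 + \<mu> s1 * (1 + (9 + (n + 1) * (14 + n * 15))) \<le> 1 + n * (10 + (n + 1) * (14 + n * 15))"
        using s1 by (simp add: \<mu>_def R_def)
    next
      fix s2 assume s2: "(\<exists>r\<le>n. R r s2) \<and> \<not> holds (ILess 16 0) s2 \<and> frame (writes row_body) s1 s2"
      then have fr: "frame (writes row_body) s1 s2" by blast
      have e2: "env s2" by (rule env_frame[OF fr]) (use s1 in \<open>auto simp: fsimps env_vars_def\<close>)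
      have "Q s2" using s1 fr unfolding Q_def by (simp add: frameD fsimps)
      obtain r where r: "R r s2" "r \<le> n" using s2 by blast
      then have "r = n" using s2 e2 by (simp add: R_def env_def)
      then show "Q s2 \<and> R n s2 \<and> env s2" using r \<open>Q s2\<close> e2 by simp
    qed
  qed
  have 3: "run \<Lambda> (cells table_size) (Basic (IAdd 14 14 4) ;; Basic (IAdd 15 15 4)) s1 2
     (\<lambda>s'. ireg s' 10 = int (j - 1) \<and> ireg s' 14 = int (idx ?D 0 0) \<and>
       ireg s' 15 = int (idx (Suc ?D) 0 0) \<and> filled s' (Suc ?D) 1 0)"
    if s1: "Q s1 \<and> R n s1 \<and> env s1" for s1
  proof -
    have "filled s1 (Suc ?D) 1 0" using s1 filled_next_layer by (simp add: R_def)
    then have "filled s' (Suc ?D) 1 0" if "rarr s' = rarr s1" "iarr s' = iarr s1" for s'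
      using that by (simp add: filled_cong)
    then have "wp \<Lambda> (cells table_size) (Basic (IAdd 14 14 4) ;; Basic (IAdd 15 15 4))
     (\<lambda>s'. ireg s' 10 = int (j - 1) \<and> ireg s' 14 = int (idx ?D 0 0) \<and>
       ireg s' 15 = int (idx (Suc ?D) 0 0) \<and> filled s' (Suc ?D) 1 0) s1"
      using s1 int_idx_Suc[of "K - j" n] int_idx_Suc[of ?D n]
      by (simp add: Q_def R_def env_def idx_wrap)
    from run_block[OF this] show ?thesis by (rule run_mono) auto
  qed
  have "run \<Lambda> (cells table_size) level_body s (12 + ((1 + n * (10 + (n + 1) * (14 + n * 15))) + 2))
     (\<lambda>s'. ireg s' 10 = int (j - 1) \<and> ireg s' 14 = int (idx ?D 0 0) \<and>
       ireg s' 15 = int (idx (Suc ?D) 0 0) \<and> filled s' (Suc ?D) 1 0)"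
    unfolding level_body_def by (rule run_Seq[OF 1 run_Seq[OF 2 3]])
  then show ?thesis by (rule run_mono) auto
qed

lemma run_table:
  assumes "env s" and s0: "ireg s 10 = int K" "ireg s 14 = 0" "ireg s 15 = (int n + 1) * (int n + 1)"
    and z: "\<And>k. rarr s 1 k = 0"
  shows "run \<Lambda> (cells table_size) (While (ILess 2 10) level_body) s
      (1 + K * (16 + n * (10 + (n + 1) * (14 + n * 15))))
     (\<lambda>s'. env s' \<and> ireg s' 10 = 0 \<and> ireg s' 15 = int (idx (Suc K) 0 0) \<and> filled s' (Suc K) 1 0)"
proof -
  note fsimps = choice_body_def cell_body_def row_body_def level_body_def
  define I where "I j s' \<longleftrightarrow> ireg s' 10 = int j \<and> ireg s' 14 = int (idx (K - j) 0 0) \<and>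
      ireg s' 15 = int (idx (Suc (K - j)) 0 0) \<and> filled s' (Suc (K - j)) 1 0" for j and s' :: state
  define \<mu> where "\<mu> s' = nat (ireg s' 10)" for s' :: state
  have "I K s" using s0 z unfolding I_def filled_def cell_ok_def
    by (auto simp: idx_def algebra_simps)
  then have "\<exists>j\<le>K. I j s" by blast
  then have "run \<Lambda> (cells table_size) (While (ILess 2 10) level_body) s
      (1 + \<mu> s * (1 + (15 + n * (10 + (n + 1) * (14 + n * 15)))))
      (\<lambda>s'. (\<exists>j\<le>K. I j s') \<and> \<not> holds (ILess 2 10) s' \<and> frame (writes level_body) s s')"
  proof (rule run_While)
    fix s2 assume "\<exists>j\<le>K. I j s2" and fr: "frame (writes level_body) s s2" and h: "holds (ILess 2 10) s2"
    have e2: "env s2" by (rule env_frame[OF fr \<open>env s\<close>]) (auto simp: fsimps env_vars_def)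
    from \<open>\<exists>j\<le>K. I j s2\<close> obtain j where j: "I j s2" "j \<le> K" by blast
    then have "1 \<le> j" using h e2 by (simp add: I_def env_def)
    have "run \<Lambda> (cells table_size) level_body s2 (15 + n * (10 + (n + 1) * (14 + n * 15)))
      (\<lambda>s'. ireg s' 10 = int (j - 1) \<and> ireg s' 14 = int (idx (Suc (K - j)) 0 0) \<and>
       ireg s' 15 = int (idx (Suc (Suc (K - j))) 0 0) \<and> filled s' (Suc (Suc (K - j))) 1 0)"
      by (rule run_level) (use e2 j \<open>1 \<le> j\<close> in \<open>auto simp: I_def\<close>)
    then show "run \<Lambda> (cells table_size) level_body s2 (15 + n * (10 + (n + 1) * (14 + n * 15)))
        (\<lambda>s'. (\<exists>j\<le>K. I j s') \<and> \<mu> s' < \<mu> s2)"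
    proof (rule run_mono)
      fix s' assume s': "ireg s' 10 = int (j - 1) \<and> ireg s' 14 = int (idx (Suc (K - j)) 0 0) \<and>
       ireg s' 15 = int (idx (Suc (Suc (K - j))) 0 0) \<and> filled s' (Suc (Suc (K - j))) 1 0"
      have "K - (j - 1) = Suc (K - j)" using j \<open>1 \<le> j\<close> by simp
      then have "I (j - 1) s'" using s' unfolding I_def by simp
      moreover have "\<mu> s' < \<mu> s2" using s' j \<open>1 \<le> j\<close> by (simp add: \<mu>_def I_def)
      ultimately show "(\<exists>j\<le>K. I j s') \<and> \<mu> s' < \<mu> s2" using j by (meson diff_le_self order_trans)
    qed simp
  qed simp
  then show ?thesis
  proof (rule run_mono)
    show "1 + \<mu> s * (1 + (15 + n * (10 + (n + 1) * (14 + n * 15))))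
        \<le> 1 + K * (16 + n * (10 + (n + 1) * (14 + n * 15)))"
      using s0 by (simp add: \<mu>_def)
  next
    fix s2 assume s2: "(\<exists>j\<le>K. I j s2) \<and> \<not> holds (ILess 2 10) s2 \<and> frame (writes level_body) s s2"
    have e2: "env s2" by (rule env_frame[OF _ \<open>env s\<close>]) (use s2 in \<open>auto simp: fsimps env_vars_def\<close>)
    obtain j where j: "I j s2" "j \<le> K" using s2 by blast
    then have "j = 0" using s2 e2 by (simp add: I_def env_def)
    then show "env s2 \<and> ireg s2 10 = 0 \<and> ireg s2 15 = int (idx (Suc K) 0 0) \<and> filled s2 (Suc K) 1 0"
      using e2 j by (simp add: I_def)
  qed
qed


text \<open>The equation is a cost balance: placed symbols pay their full lengths, the others have
  paid down to the previous level \<open>lam (K - d)\<close>, and \<open>val\<close> accounts for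
  the rest. The bound on \<open>X + m\<close> says that the \<open>m\<close> nodes from
  \<open>X\<close> on exist, and \<open>val d r m < 0\<close> that the path is feasible.\<close>

definition trace_inv ::
  "nat \<Rightarrow> nat \<Rightarrow> nat \<Rightarrow> nat \<Rightarrow> (nat \<Rightarrow> int) \<Rightarrow> (nat \<Rightarrow> int) \<Rightarrow> bool" where
  "trace_inv d r m X a v \<longleftrightarrow> 1 \<le> d \<and> d \<le> K \<and> 1 \<le> m \<and> m \<le> r \<and> r \<le> n \<and> val d r m < 0 \<and>
     X + m \<le> 2 ^ lam (K + 1 - d) \<and> canonical \<Lambda> (n - r) (int X) (lam (K + 1 - d)) a v \<and>
     (\<Sum>i=1..n-r. p i * real_of_int (a i)) + real (lam (K - d)) * tail r + val d r m
       = val K n root_slots"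

lemma trace_inv_init: "trace_inv K n root_slots 0 a v"
  using K_pos n_pos val_root_neg
  by (auto simp: trace_inv_def root_slots_def canonical_def)

text \<open>One step along the optimal path: \<open>good_choice\<close> splits
  \<open>val d r m\<close> into the charge for this level and the value of the next configuration.
  If \<open>r \<le> m\<close>, only \<open>- B\<close> is left of the value, and the balance becomes
  the exact cost.\<close>

lemma trace_choice:
  assumes inv: "trace_inv d r m X a v" and g: "good_choice d r m k"
    and can: "canonical \<Lambda> (n - (r - k)) (int (X + k)) (lam (K + 1 - d)) a' v'"
    and sum: "(\<Sum>i=1..n-(r-k). p i * real_of_int (a' i)) + real (lam (K + 1 - d)) * tail (r - k)
       = (\<Sum>i=1..n-r. p i * real_of_int (a i)) + real (lam (K + 1 - d)) * tail r"
  shows "k \<le> m"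
    and "r \<le> m \<Longrightarrow> k = r \<and> (\<Sum>i=1..n. p i * real_of_int (a' i)) = val K n root_slots + B"
    and "m < r \<Longrightarrow> trace_inv (d - 1) (r - k) (slots (K + 1 - d) (r - k) (m - k))
      ((X + k) * 2 ^ lam (K + 2 - d) div 2 ^ lam (K + 1 - d)) a' v'"
proof -
  define j where "j = K + 1 - d"
  note I = inv[unfolded trace_inv_def, folded j_def]
  have j: "1 \<le> j" "j \<le> K" "K - d = j - 1" "K + 2 - d = Suc j" using I by (auto simp: j_def)
  obtain e where d: "d = Suc e" using I by (cases d) auto
  then have d1: "d - 1 = e" by simp
  have e: "K - e = j" "K - Suc e = j - 1" using I by (auto simp: j_def d)
  have val: "val d r m = (real (lam j) - real (lam (j - 1))) * tail r +
     (if r \<le> m then - B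
      else running_min (\<lambda>s. val e (r - s) (slots j (r - s) (m - s))) m)"
    unfolding d val.simps e by simp
  have g': "if r \<le> m then k = r else k < m \<and>
      running_min (\<lambda>s. val e (r - s) (slots j (r - s) (m - s))) m = val e (r - k) (slots j (r - k) (m - k))"
    using g unfolding good_choice_def j_def[symmetric] d1 .
  show "k \<le> m" using g' I by (auto split: if_splits)
  { assume rm: "r \<le> m"
    then have "k = r" using g' by simp
    moreover have "(\<Sum>i=1..n. p i * real_of_int (a' i)) = val K n root_slots + B"
      using sum[folded j_def] I val rm \<open>k = r\<close> by (simp add: j algebra_simps)
    ultimately show "k = r \<and> (\<Sum>i=1..n. p i * real_of_int (a' i)) = val K n root_slots + B" by simp }
  { assume rm: "m < r"
    define m' where "m' = slots j (r - k) (m - k)"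
    have k: "k < m" and v: "val d r m = (real (lam j) - real (lam (j - 1))) * tail r + val e (r - k) m'"
      using g' rm val by (auto simp: m'_def)
    have "0 \<le> (real (lam j) - real (lam (j - 1))) * tail r"
      using lam_le[of "j - 1" j] j tail_nonneg by simp
    then have neg: "val e (r - k) m' < 0" using v I by simp
    \<comment> \<open>Layer \<open>0\<close> has value \<open>0\<close>, so a negative value
      guarantees a further level.\<close>
    then have "1 \<le> e" by (cases e) auto
    then have jK: "j < K" using e K_pos by simp
    have "min (r - k) (2 * (m - k)) \<le> m'" unfolding m'_def by (rule slots_double[OF jK])
    then have m'1: "1 \<le> m'" using k rm by simp
    have lle: "lam j \<le> lam (Suc j)" using lam_le[of j "Suc j"] jK by simp
    define g where "g = lam (Suc j) - lam j"
    have pow: "(2::nat) ^ lam (Suc j) = 2 ^ g * 2 ^ lam j" using lle by (simp add: g_def flip: power_add)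
    have X': "(X + k) * 2 ^ lam (Suc j) div 2 ^ lam j = (X + k) * 2 ^ g"
      unfolding pow by (simp add: mult.assoc[symmetric])
    have "m' \<le> (m - k) * 2 ^ g" unfolding m'_def slots_eq[OF jK] g_def by simp
    then have "(X + k) * 2 ^ g + m' \<le> (X + k + (m - k)) * 2 ^ g" by (simp add: distrib_right)
    also have "X + k + (m - k) = X + m" using k by simp
    also have "(X + m) * 2 ^ g \<le> 2 ^ lam j * 2 ^ g" using I by (intro mult_le_mono1) simp
    also have "\<dots> = 2 ^ lam (Suc j)" unfolding pow by simp
    finally have bound: "(X + k) * 2 ^ g + m' \<le> 2 ^ lam (Suc j)" .
    have can': "canonical \<Lambda> (n - (r - k)) (int ((X + k) * 2 ^ g)) (lam (Suc j)) a' v'"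
      using canonical_descend[OF can[folded j_def] lle] by (simp add: g_def)
    have s: "(\<Sum>i=1..n-(r-k). p i * real_of_int (a' i)) + real (lam j) * tail (r - k) + val e (r - k) m'
       = val K n root_slots"
      using sum I v unfolding j_def[symmetric] j by (simp add: algebra_simps)
    have eK: "e \<le> K" "K + 1 - e = Suc j" using I d e(1) by (auto simp: Suc_diff_le)
    have rk: "r - k \<le> n" using I by linarith
    have "trace_inv e (r - k) m' ((X + k) * 2 ^ g) a' v'"
      unfolding trace_inv_def eK(2)
      using \<open>1 \<le> e\<close> eK(1) e jK m'1 slots_le[of j "r - k" "m - k"] rk neg bound can' s
      by (simp add: m'_def[symmetric] d)
    then show "trace_inv (d - 1) (r - k) (slots (K + 1 - d) (r - k) (m - k))
      ((X + k) * 2 ^ lam (K + 2 - d) div 2 ^ lam (K + 1 - d)) a' v'"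
      unfolding j_def[symmetric] j X' by (simp add: d m'_def) }
qed

text \<open>Symbols are placed in order of their indices, so the remaining ones are always the last.
  Each round moves \<open>p u * lam j\<close> from the tail term to the sum and keeps the
  balance.\<close>

lemma run_assign:
  assumes "env s" and j: "1 \<le> j" "j \<le> K" and le: "k \<le> m" "q + k \<le> n" "X + m \<le> 2 ^ lam j"
    and s0: "ireg s 11 = int (lam j)" "ireg s 16 = int n - int q" "ireg s 17 = int m"
      "ireg s 23 = int k" "ireg s 26 = int X" "ireg s 27 = int q"
    and can: "canonical \<Lambda> q (int X) (lam j) (iarr s 0) (iarr s 1)"
  shows "run \<Lambda> (cells table_size) (While (ILess 2 23) assign_body) s (1 + n * 9)
    (\<lambda>s'. ireg s' 16 = int n - int (q + k) \<and> ireg s' 17 = int (m - k) \<and> ireg s' 26 = int (X + k) \<and>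
      ireg s' 27 = int (q + k) \<and> ireg s' 15 = ireg s 15 - int k * (int n + 1) \<and>
      canonical \<Lambda> (q + k) (int (X + k)) (lam j) (iarr s' 0) (iarr s' 1) \<and>
      (\<Sum>i=1..q+k. p i * real_of_int (iarr s' 0 i)) + real (lam j) * tail (n - (q + k))
       = (\<Sum>i=1..q. p i * real_of_int (iarr s 0 i)) + real (lam j) * tail (n - q))"
proof -
  define I where "I t s' \<longleftrightarrow> ireg s' 16 = int n - int (q + t) \<and> ireg s' 17 = int m - int t \<and>
      ireg s' 23 = int k - int t \<and> ireg s' 26 = int (X + t) \<and>
      ireg s' 27 = int (q + t) \<and> ireg s' 15 = ireg s 15 - int t * (int n + 1) \<and>
      canonical \<Lambda> (q + t) (int (X + t)) (lam j) (iarr s' 0) (iarr s' 1) \<and>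
      (\<Sum>i=1..q+t. p i * real_of_int (iarr s' 0 i)) + real (lam j) * tail (n - (q + t))
       = (\<Sum>i=1..q. p i * real_of_int (iarr s 0 i)) + real (lam j) * tail (n - q)" for t and s' :: state
  define \<mu> where "\<mu> s' = nat (ireg s' 23)" for s' :: state
  have "I 0 s" using s0 can unfolding I_def by simp
  then have "\<exists>t\<le>k. I t s" by blast
  then have "run \<Lambda> (cells table_size) (While (ILess 2 23) assign_body) s (1 + \<mu> s * (1 + 8))
    (\<lambda>s'. (\<exists>t\<le>k. I t s') \<and> \<not> holds (ILess 2 23) s' \<and> frame (writes assign_body) s s')"
  proof (rule run_While)
    fix s2 assume "\<exists>t\<le>k. I t s2" and fr: "frame (writes assign_body) s s2" and h: "holds (ILess 2 23) s2"
    have e2: "env s2" by (rule env_frame[OF fr \<open>env s\<close>]) (auto simp: assign_body_def env_vars_def)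
    have c: "ireg s2 11 = int (lam j)" using fr s0 by (simp add: frameD assign_body_def)
    from \<open>\<exists>t\<le>k. I t s2\<close> obtain t where t: "I t s2" "t \<le> k" by blast
    then have "t < k" using h e2 by (simp add: I_def env_def)
    define u where "u = Suc (q + t)"
    have u: "u \<le> n" "q + t = u - 1" "1 \<le> u" using \<open>t < k\<close> le by (auto simp: u_def)
    have "X + t < 2 ^ lam j" using \<open>t < k\<close> le by simp
    then have lt: "int (X + t) < 2 ^ lam j" by (metis of_nat_less_iff of_nat_numeral of_nat_power)
    have can2: "canonical \<Lambda> u (int (X + t) + 1) (lam j) ((iarr s2 0)(u := int (lam j))) ((iarr s2 1)(u := int (X + t)))"
      unfolding u_def by (rule canonical_add) (use t lam_in pos j lt in \<open>auto simp: I_def\<close>)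
    have "n - (q + t) = Suc (n - u)" using u by simp
    then have tl: "tail (n - (q + t)) = tail (n - u) + p u"
      using tail_Suc[of "n - u"] u by simp
    have "(\<Sum>i=1..u. p i * real_of_int (((iarr s2 0)(u := int (lam j))) i)) =
        (\<Sum>i=1..q+t. p i * real_of_int (iarr s2 0 i)) + p u * real (lam j)"
      by (simp add: u_def)
    moreover have "real (lam j) * (tail (n - u) + p u) = real (lam j) * tail (n - u) + p u * real (lam j)"
      by (simp add: algebra_simps)
    moreover have "(\<Sum>i=1..q+t. p i * real_of_int (iarr s2 0 i)) + real (lam j) * tail (n - (q + t))
       = (\<Sum>i=1..q. p i * real_of_int (iarr s 0 i)) + real (lam j) * tail (n - q)"
      and t15: "ireg s2 15 = ireg s 15 - int t * (int n + 1)"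
      using t(1) unfolding I_def by blast+
    ultimately have sum2: "(\<Sum>i=1..u. p i * real_of_int (((iarr s2 0)(u := int (lam j))) i)) + real (lam j) * tail (n - u)
       = (\<Sum>i=1..q. p i * real_of_int (iarr s 0 i)) + real (lam j) * tail (n - q)"
      unfolding tl by linarith
    have ub: "u < table_size" by (rule lam_index) (use u in simp)
    have iu: "int u = int (q + t) + 1" "nat (int (q + t) + 1) = u" by (simp_all add: u_def)
    have I': "I (Suc t) s3" if "ireg s3 16 = int n - int (q + t) - 1" "ireg s3 17 = int m - int t - 1"
      "ireg s3 23 = int k - int t - 1" "ireg s3 26 = int (X + t) + 1" "ireg s3 27 = int (q + t) + 1"
      "ireg s3 15 = ireg s2 15 - (int n + 1)"
      "iarr s3 0 = (iarr s2 0)(u := int (lam j))" "iarr s3 1 = (iarr s2 1)(u := int (X + t))" for s3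
    proof -
      have qt: "q + Suc t = u" "int (X + Suc t) = int (X + t) + 1" "int (Suc t) = int t + 1"
        by (simp_all add: u_def)
      show ?thesis
        unfolding I_def qt iu that t15
        using can2 sum2 by (intro conjI) (simp_all only: algebra_simps)
    qed
    have regs: "ireg s2 16 = int n - int (q + t)" "ireg s2 17 = int m - int t"
      "ireg s2 23 = int k - int t" "ireg s2 26 = int (X + t)" "ireg s2 27 = int (q + t)"
      "ireg s2 3 = - 1" "ireg s2 30 = 1" "ireg s2 5 = - (int n + 1)"
      using t e2 by (simp_all add: I_def env_def)
    have "wp \<Lambda> (cells table_size) assign_body (\<lambda>s'. I (Suc t) s' \<and> \<mu> s' < \<mu> s2) s2"
      using ub iu(2) \<open>t < k\<close> unfolding assign_body_def \<mu>_def
      by (auto simp: regs c simp del: of_nat_add intro!: I')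
    from run_block[OF this, of 8]
    show "run \<Lambda> (cells table_size) assign_body s2 8 (\<lambda>s'. (\<exists>t\<le>k. I t s') \<and> \<mu> s' < \<mu> s2)"
    proof (rule run_mono)
      fix s' assume "(I (Suc t) s' \<and> \<mu> s' < \<mu> s2) \<and> frame (writes assign_body) s2 s'"
      then show "(\<exists>t\<le>k. I t s') \<and> \<mu> s' < \<mu> s2" using \<open>t < k\<close> by (meson Suc_leI)
    qed (simp_all add: assign_body_def)
  qed simp
  then show ?thesis
  proof (rule run_mono)
    show "1 + \<mu> s * (1 + 8) \<le> 1 + n * 9" using s0 le by (simp add: \<mu>_def)
  next
    fix s2 assume s2: "(\<exists>t\<le>k. I t s2) \<and> \<not> holds (ILess 2 23) s2 \<and> frame (writes assign_body) s s2"
    have e2: "env s2"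
      by (rule env_frame[OF _ \<open>env s\<close>]) (use s2 in \<open>auto simp: assign_body_def env_vars_def\<close>)
    obtain t where t: "I t s2" "t \<le> k" using s2 by blast
    then have "t = k" using s2 e2 by (simp add: I_def env_def)
    then show "ireg s2 16 = int n - int (q + k) \<and> ireg s2 17 = int (m - k) \<and> ireg s2 26 = int (X + k) \<and>
      ireg s2 27 = int (q + k) \<and> ireg s2 15 = ireg s 15 - int k * (int n + 1) \<and>
      canonical \<Lambda> (q + k) (int (X + k)) (lam j) (iarr s2 0) (iarr s2 1) \<and>
      (\<Sum>i=1..q+k. p i * real_of_int (iarr s2 0 i)) + real (lam j) * tail (n - (q + k))
       = (\<Sum>i=1..q. p i * real_of_int (iarr s 0 i)) + real (lam j) * tail (n - q)"
      using t(1) le(1) unfolding I_def by (simp add: of_nat_diff)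
  qed
qed

lemma run_descend:
  assumes "env s" and j: "j \<le> K"
    and s0: "ireg s 10 = int j" "ireg s 11 = int (lam j)" "ireg s 16 = int b" "ireg s 17 = int a"
      "ireg s 26 = int X"
  shows "run \<Lambda> (cells table_size)
     (Basic (IAdd 10 10 30) ;;
      Basic (ILoad 12 2 10) ;;
      Basic (IShl 17 17 12) ;;
      Basic (IShr 17 17 11) ;;
      Cond (ILess 16 17) (Basic (ICopy 17 16)) skip ;;
      Basic (IShl 26 26 12) ;;
      Basic (IShr 26 26 11) ;;
      Basic (ICopy 11 12) ;;
      Basic (IAdd 15 15 29)) s 10
     (\<lambda>s'. ireg s' 10 = int (Suc j) \<and> ireg s' 11 = int (lam (Suc j)) \<and> ireg s' 16 = int b \<and>
       ireg s' 17 = int (slots j b a) \<and> ireg s' 26 = int (X * 2 ^ lam (Suc j) div 2 ^ lam j) \<and>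
       ireg s' 15 = ireg s 15 - (int n + 1) * (int n + 1) \<and> ireg s' 27 = ireg s 27 \<and>
       iarr s' = iarr s)" (is "run _ _ ?c _ _ ?Q")
proof -
  define x where "x = a * 2 ^ lam (Suc j) div 2 ^ lam j"
  have sl: "slots j b a = (if b < x then b else x)" by (simp add: slots_def x_def)
  have regs: "ireg s 30 = 1" "ireg s 29 = - ((int n + 1) * (int n + 1))" "iarr s 2 = (\<lambda>k. int (lam k))"
    using \<open>env s\<close> by (auto simp: env_def)
  have lt: "Suc j < table_size" by (rule lam_index) (use j K_le in simp)
  have i: "nat (int j + 1) = Suc j" by simp
  have "wp \<Lambda> (cells table_size) ?c ?Q s"
    using lt unfolding sl
    by (cases "b < x") (auto simp: s0 regs i shift_int x_def[symmetric] simp del: of_nat_mult)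
  from run_block[OF this, of 10] show ?thesis by (rule run_mono) auto
qed

lemma run_trace:
  assumes "env s" and fl: "filled s (Suc K) 1 0"
    and s0: "ireg s 10 = 1" "ireg s 11 = int (lam 1)" "ireg s 15 = int (idx K n 0)" "ireg s 16 = int n"
      "ireg s 17 = int root_slots" "ireg s 26 = 0" "ireg s 27 = 0"
  shows "run \<Lambda> (cells table_size) (While (ILess 2 16) trace_body) s (1 + K * (14 + n * 9))
     (\<lambda>s'. \<exists>X lev. canonical \<Lambda> n X lev (iarr s' 0) (iarr s' 1) \<and>
       (\<Sum>i=1..n. p i * real_of_int (iarr s' 0 i)) = val K n root_slots + B)"
proof -
  define T where "T d r m X s' \<longleftrightarrow> trace_inv d r m X (iarr s' 0) (iarr s' 1) \<and>
     ireg s' 16 = int r \<and> ireg s' 17 = int m \<and> ireg s' 26 = int X \<and> ireg s' 27 = int (n - r) \<and>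
     ireg s' 10 = int (K + 1 - d) \<and> ireg s' 11 = int (lam (K + 1 - d)) \<and> ireg s' 15 = int (idx d r 0)"
    for d r m X and s' :: state
  \<comment> \<open>After the last symbol is placed, the round still descends, possibly beyond level
    \<open>K\<close>, and leaves meaningless registers. \<open>F\<close> therefore keeps only the
    finished code.\<close>
  define F where "F s' \<longleftrightarrow> ireg s' 16 = 0 \<and>
     (\<exists>X lev. canonical \<Lambda> n X lev (iarr s' 0) (iarr s' 1) \<and>
       (\<Sum>i=1..n. p i * real_of_int (iarr s' 0 i)) = val K n root_slots + B)" for s' :: state
  define I where "I s' \<longleftrightarrow> (\<exists>d r m X. T d r m X s') \<or> F s'" for s' :: state
  define \<mu> where "\<mu> s' = (if ireg s' 16 = 0 then 0 else nat (int K + 1 - ireg s' 10))" for s' :: state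
  note fsimps = assign_body_def trace_body_def
  have "T K n root_slots 0 s" unfolding T_def using s0 trace_inv_init by simp
  then have "I s" unfolding I_def by blast
  then have "run \<Lambda> (cells table_size) (While (ILess 2 16) trace_body) s (1 + \<mu> s * (1 + (13 + n * 9)))
    (\<lambda>s'. I s' \<and> \<not> holds (ILess 2 16) s' \<and> frame (writes trace_body) s s')"
  proof (rule run_While)
    fix s1 assume "I s1" and fr: "frame (writes trace_body) s s1" and h: "holds (ILess 2 16) s1"
    have e1: "env s1" by (rule env_frame[OF fr \<open>env s\<close>]) (auto simp: fsimps env_vars_def)
    have fl1: "filled s1 (Suc K) 1 0"
      by (rule filled_cong[OF fl]) (use fr in \<open>auto simp: frameD fsimps\<close>)
    have "0 < ireg s1 16" using h e1 by (simp add: env_def)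
    then obtain d r m X where T: "T d r m X s1" using \<open>I s1\<close> unfolding I_def F_def by auto
    define j where "j = K + 1 - d"
    have inv: "trace_inv d r m X (iarr s1 0) (iarr s1 1)" using T by (simp add: T_def)
    then have b: "1 \<le> d" "d \<le> K" "1 \<le> m" "m \<le> r" "r \<le> n" "val d r m < 0" "X + m \<le> 2 ^ lam j"
        "canonical \<Lambda> (n - r) (int X) (lam j) (iarr s1 0) (iarr s1 1)"
      unfolding trace_inv_def j_def by auto
    have j: "1 \<le> j" "j \<le> K" using b by (auto simp: j_def)
    have regs: "ireg s1 16 = int r" "ireg s1 17 = int m" "ireg s1 26 = int X" "ireg s1 27 = int (n - r)"
      "ireg s1 10 = int j" "ireg s1 11 = int (lam j)" "ireg s1 15 = int (idx d r 0)"
      using T by (simp_all add: T_def j_def)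
    have "cell_ok s1 d r m" using fl1 b unfolding filled_def by simp
    then obtain k where k: "iarr s1 3 (idx d r m) = int k" "good_choice d r m k"
      using b unfolding cell_ok_def by blast
    then have km: "k \<le> m" using b by (auto simp: good_choice_def split: if_splits)
    have ad: "nat (int (idx d r 0) + int m) = idx d r m" by (metis idx_add nat_int of_nat_add)
    have "idx d r m < table_size" using b by (intro idx_less) auto
    then have "wp \<Lambda> (cells table_size) (Basic (IAdd 25 15 17) ;; Basic (ILoad 23 3 25)) (\<lambda>s'. ireg s' 23 = int k) s1"
      by (simp add: regs ad k)
    from run_block[OF this, of 2]
    have 1: "run \<Lambda> (cells table_size) (Basic (IAdd 25 15 17) ;; Basic (ILoad 23 3 25)) s1 2
      (\<lambda>s'. ireg s' 23 = int k \<and> frame {IVar 25, IVar 23} s1 s')"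
      by (simp add: insert_commute)
    define q where "q = n - r"
    have q: "int n - int q = int r" "q + k = n - (r - k)" "n - q = r" "n - (q + k) = r - k"
      "int n - int (q + k) = int (r - k)" "q + k \<le> n"
      using b km by (auto simp: q_def)
    define P where "P s' \<longleftrightarrow> env s' \<and> ireg s' 10 = int j \<and> ireg s' 11 = int (lam j) \<and>
      ireg s' 16 = int (r - k) \<and> ireg s' 17 = int (m - k) \<and> ireg s' 26 = int (X + k) \<and>
      ireg s' 27 = int (n - (r - k)) \<and> ireg s' 15 = int (idx d r 0) - int k * (int n + 1) \<and>
      canonical \<Lambda> (n - (r - k)) (int (X + k)) (lam j) (iarr s' 0) (iarr s' 1) \<and>
      (\<Sum>i=1..n-(r-k). p i * real_of_int (iarr s' 0 i)) + real (lam j) * tail (r - k)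
       = (\<Sum>i=1..n-r. p i * real_of_int (iarr s1 0 i)) + real (lam j) * tail r" for s' :: state
    have 2: "run \<Lambda> (cells table_size) (While (ILess 2 23) assign_body) s2 (1 + n * 9) P"
      if s2: "ireg s2 23 = int k \<and> frame {IVar 25, IVar 23} s1 s2" for s2
    proof -
      have e2: "env s2" by (rule env_frame[OF conjunct2[OF s2] e1]) (simp add: env_vars_def)
      have same: "ireg s2 16 = int n - int q" "ireg s2 17 = int m" "ireg s2 26 = int X" "ireg s2 27 = int q"
        "ireg s2 10 = int j" "ireg s2 11 = int (lam j)" "ireg s2 15 = int (idx d r 0)"
        "iarr s2 = iarr s1"
        using s2 regs q(1) by (auto simp: frame_def q_def)
      have "run \<Lambda> (cells table_size) (While (ILess 2 23) assign_body) s2 (1 + n * 9)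
        (\<lambda>s'. ireg s' 16 = int n - int (q + k) \<and> ireg s' 17 = int (m - k) \<and> ireg s' 26 = int (X + k) \<and>
        ireg s' 27 = int (q + k) \<and> ireg s' 15 = ireg s2 15 - int k * (int n + 1) \<and>
        canonical \<Lambda> (q + k) (int (X + k)) (lam j) (iarr s' 0) (iarr s' 1) \<and>
        (\<Sum>i=1..q+k. p i * real_of_int (iarr s' 0 i)) + real (lam j) * tail (n - (q + k))
         = (\<Sum>i=1..q. p i * real_of_int (iarr s2 0 i)) + real (lam j) * tail (n - q))"
        by (rule run_assign) (use e2 j km q b same s2 in \<open>simp_all add: q_def\<close>)
      from run_frame[OF this] show ?thesis
      proof (rule run_mono)
        fix s3 assume s3: "(ireg s3 16 = int n - int (q + k) \<and> ireg s3 17 = int (m - k) \<and> ireg s3 26 = int (X + k) \<and>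
        ireg s3 27 = int (q + k) \<and> ireg s3 15 = ireg s2 15 - int k * (int n + 1) \<and>
        canonical \<Lambda> (q + k) (int (X + k)) (lam j) (iarr s3 0) (iarr s3 1) \<and>
        (\<Sum>i=1..q+k. p i * real_of_int (iarr s3 0 i)) + real (lam j) * tail (n - (q + k))
         = (\<Sum>i=1..q. p i * real_of_int (iarr s2 0 i)) + real (lam j) * tail (n - q)) \<and>
         frame (writes (While (ILess 2 23) assign_body)) s2 s3"
        have "env s3" by (rule env_frame[OF conjunct2[OF s3] e2]) (simp add: fsimps env_vars_def)
        moreover have "ireg s3 10 = int j" "ireg s3 11 = int (lam j)"
          using s3 same by (auto simp: frame_def fsimps)
        ultimately show "P s3"
          using s3 unfolding P_def q(2)[symmetric] q_def[symmetric] same q(3-5) by auto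
      qed simp
    qed
    let ?c = "Basic (IAdd 10 10 30) ;; Basic (ILoad 12 2 10) ;; Basic (IShl 17 17 12) ;;
      Basic (IShr 17 17 11) ;; Cond (ILess 16 17) (Basic (ICopy 17 16)) skip ;;
      Basic (IShl 26 26 12) ;; Basic (IShr 26 26 11) ;; Basic (ICopy 11 12) ;; Basic (IAdd 15 15 29)"
    have 3: "run \<Lambda> (cells table_size) ?c s3 10 (\<lambda>s'. I s' \<and> \<mu> s' < \<mu> s1)" if "P s3" for s3
    proof -
      have P: "env s3" "ireg s3 10 = int j" "ireg s3 11 = int (lam j)"
      "ireg s3 16 = int (r - k)" "ireg s3 17 = int (m - k)" "ireg s3 26 = int (X + k)"
      "ireg s3 27 = int (n - (r - k))" "ireg s3 15 = int (idx d r 0) - int k * (int n + 1)"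
      "canonical \<Lambda> (n - (r - k)) (int (X + k)) (lam (K + 1 - d)) (iarr s3 0) (iarr s3 1)"
      "(\<Sum>i=1..n-(r-k). p i * real_of_int (iarr s3 0 i)) + real (lam (K + 1 - d)) * tail (r - k)
       = (\<Sum>i=1..n-r. p i * real_of_int (iarr s1 0 i)) + real (lam (K + 1 - d)) * tail r"
        using that unfolding P_def j_def by blast+
      note choice = trace_choice[OF inv k(2) P(9,10)]
      have mu1: "\<mu> s1 = d" using regs b by (simp add: \<mu>_def j_def of_nat_diff)
      from run_descend[OF P(1) j(2) P(2-6)]
      show ?thesis
      proof (rule run_mono)
        fix s4 :: state assume s4: "ireg s4 10 = int (Suc j) \<and> ireg s4 11 = int (lam (Suc j)) \<and> ireg s4 16 = int (r - k) \<and>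
          ireg s4 17 = int (slots j (r - k) (m - k)) \<and>
          ireg s4 26 = int ((X + k) * 2 ^ lam (Suc j) div 2 ^ lam j) \<and>
          ireg s4 15 = ireg s3 15 - (int n + 1) * (int n + 1) \<and> ireg s4 27 = ireg s3 27 \<and>
          iarr s4 = iarr s3"
        show "I s4 \<and> \<mu> s4 < \<mu> s1"
        proof (cases "r \<le> m")
          case True
          then have "k = r" using choice(2) by simp
          then have "F s4" using s4 choice(2)[OF True] P(9) unfolding F_def by auto
          then show ?thesis using b(1) unfolding I_def mu1 by (simp add: \<mu>_def F_def)
        next
          case False
          have kj: "K + 1 - (d - 1) = Suc j" "K + 2 - d = Suc j" using b by (auto simp: j_def)
          have "idx d r 0 = idx (d - 1) (r - k) 0 + k * (n + 1) + (n + 1) * (n + 1)"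
          proof -
            obtain e where "d = Suc e" using b by (cases d) auto
            moreover obtain f where "r = f + k" using km b by (metis le_add_diff_inverse2 order_trans)
            ultimately show ?thesis by (simp add: idx_def algebra_simps)
          qed
          then have "int (idx d r 0) = int (idx (d - 1) (r - k) 0) + int k * (int n + 1) + (int n + 1) * (int n + 1)"
            by (simp add: algebra_simps)
          then have i15: "ireg s4 15 = int (idx (d - 1) (r - k) 0)" using s4 P(8) by linarith
          have "trace_inv (d - 1) (r - k) (slots j (r - k) (m - k))
             ((X + k) * 2 ^ lam (Suc j) div 2 ^ lam j) (iarr s4 0) (iarr s4 1)"
            using choice(3) False s4 unfolding kj j_def[symmetric] by simp
          then have "T (d - 1) (r - k) (slots j (r - k) (m - k)) ((X + k) * 2 ^ lam (Suc j) div 2 ^ lam j) s4"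
            using s4 P(7) i15 unfolding T_def kj by simp
          moreover have "\<mu> s4 < d"
          proof (cases "ireg s4 16 = 0")
            case False
            then show ?thesis using s4 b unfolding \<mu>_def by (simp add: j_def)
          qed (use b in \<open>simp add: \<mu>_def\<close>)
          ultimately show ?thesis unfolding I_def mu1 by blast
        qed
      qed simp
    qed
    have "run \<Lambda> (cells table_size) trace_body s1 (2 + ((1 + n * 9) + 10)) (\<lambda>s'. I s' \<and> \<mu> s' < \<mu> s1)"
      unfolding trace_body_def by (rule run_Seq[OF 1 run_Seq[OF 2 3]])
    then show "run \<Lambda> (cells table_size) trace_body s1 (13 + n * 9) (\<lambda>s'. I s' \<and> \<mu> s' < \<mu> s1)"
      by (rule run_mono) auto
  qed simp
  then show ?thesis
  proof (rule run_mono)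
    show "1 + \<mu> s * (1 + (13 + n * 9)) \<le> 1 + K * (14 + n * 9)"
      using s0 by (simp add: \<mu>_def)
  next
    fix s2 assume s2: "I s2 \<and> \<not> holds (ILess 2 16) s2 \<and> frame (writes trace_body) s s2"
    have e2: "env s2" by (rule env_frame[OF _ \<open>env s\<close>]) (use s2 in \<open>auto simp: fsimps env_vars_def\<close>)
    then have "F s2" using s2 by (auto simp: I_def T_def env_def trace_inv_def)
    then show "\<exists>X lev. canonical \<Lambda> n X lev (iarr s2 0) (iarr s2 1) \<and>
       (\<Sum>i=1..n. p i * real_of_int (iarr s2 0 i)) = val K n root_slots + B"
      by (simp add: F_def)
  qed
qed

lemma lam_pos_iff: "1 \<le> i \<Longrightarrow> 0 < lam i \<longleftrightarrow> i \<le> K"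
  using lam_less[of 0 i] lam_beyond[of i] by (cases "i \<le> K") auto

lemma run_read_input:
  "run \<Lambda> (cells table_size) read_input (init_state n p) (14 + n * 10)
     (\<lambda>s'. env s' \<and> ireg s' 10 = int K \<and> ireg s' 15 = (int n + 1) * (int n + 1))"
proof -
  define E where "E s' \<longleftrightarrow> ireg s' 0 = int n \<and> ireg s' 2 = 0 \<and> ireg s' 3 = - 1 \<and> ireg s' 30 = 1 \<and>
     ireg s' 4 = int n + 1 \<and> (\<forall>k\<in>{1..n}. rarr s' 0 k = p k) \<and> rreg s' 5 = - 1" for s' :: state
  define I where "I k s' \<longleftrightarrow> ireg s' 8 = int k \<and> rpos s' = k \<and> ireg s' 6 = (int n + 1) * (int k + 1) \<and>
     ireg s' 5 = - (int k + 1) \<and> ireg s' 29 = - ((int k + 1) * (int k + 1)) \<and>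
     ireg s' 7 = int (min k K) \<and>
     (\<forall>i. iarr s' 2 i = (if i \<le> k then int (lam i) else 0))" for k and s' :: state
  define \<mu> where "\<mu> s' = nat (int n - ireg s' 8)" for s' :: state
  let ?a = "Basic (IConst 30 1) ;; Basic (IConst 3 (-1)) ;; Basic (IAdd 4 0 30) ;;
      Basic (ICopy 6 4) ;; Basic (ICopy 5 3) ;; Basic (ICopy 29 3) ;; Basic (RConst 5 (-1))"
  have "wp \<Lambda> (cells table_size) ?a (\<lambda>s'. E s' \<and> I 0 s') (init_state n p)"
    by (auto simp: E_def I_def init_state_def)
  from run_block[OF this, of 7]
  have 1: "run \<Lambda> (cells table_size) ?a (init_state n p) 7 (\<lambda>s'. E s' \<and> I 0 s')"
    by (rule run_mono) auto
  have 2: "run \<Lambda> (cells table_size) (While (ILess 8 0) read_body) s1 (1 + n * 10) (\<lambda>s'. E s' \<and> I n s')"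
    if s1: "E s1 \<and> I 0 s1" for s1
  proof -
    have "\<exists>k\<le>n. I k s1" using s1 by blast
    then have "run \<Lambda> (cells table_size) (While (ILess 8 0) read_body) s1 (1 + \<mu> s1 * (1 + 9))
      (\<lambda>s'. (\<exists>k\<le>n. I k s') \<and> \<not> holds (ILess 8 0) s' \<and> frame (writes read_body) s1 s')"
    proof (rule run_While)
      fix s2 assume "\<exists>k\<le>n. I k s2" and fr: "frame (writes read_body) s1 s2" and h: "holds (ILess 8 0) s2"
      have regs: "ireg s2 0 = int n" "ireg s2 2 = 0" "ireg s2 3 = - 1" "ireg s2 30 = 1" "ireg s2 4 = int n + 1"
        using s1 fr unfolding E_def by (simp_all add: frameD read_body_def)
      from \<open>\<exists>k\<le>n. I k s2\<close> obtain k where k: "I k s2" "k \<le> n" by blast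
      then have "k < n" using h regs by (simp add: I_def)
      have el: "input_elem \<Lambda> k = lam (Suc k)" using \<open>k < n\<close> by (simp add: lam_def)
      have lt: "Suc k < table_size" by (rule lam_index) (use \<open>k < n\<close> in simp)
      have i: "nat (int k + 1) = Suc k" by simp
      have lp: "0 < lam (Suc k) \<longleftrightarrow> Suc k \<le> K" by (rule lam_pos_iff) simp
      have kregs: "ireg s2 8 = int k" "rpos s2 = k" "ireg s2 6 = (int n + 1) * (int k + 1)"
        "ireg s2 5 = - (int k + 1)" "ireg s2 29 = - ((int k + 1) * (int k + 1))" "ireg s2 7 = int (min k K)"
        "iarr s2 2 = (\<lambda>i. if i \<le> k then int (lam i) else 0)"
        using k by (auto simp: I_def)
      have I': "I (Suc k) s3 \<and> \<mu> s3 < \<mu> s2" if "ireg s3 8 = int k + 1" "rpos s3 = Suc k"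
        "ireg s3 6 = (int n + 1) * (int k + 1) + (int n + 1)" "ireg s3 5 = - 2 - int k"
        "ireg s3 29 = - (2 * int k) - (int k + 1) * (int k + 1) - 3"
        "ireg s3 7 = (if 0 < int (lam (Suc k)) then int (min k K) + 1 else int (min k K))"
        "iarr s3 2 = (iarr s2 2)(Suc k := int (lam (Suc k)))" for s3
        using that lp \<open>k < n\<close> unfolding I_def \<mu>_def kregs
        by (auto simp: algebra_simps min_def le_Suc_eq)
      have "wp \<Lambda> (cells table_size) read_body (\<lambda>s'. I (Suc k) s' \<and> \<mu> s' < \<mu> s2) s2"
        using lt unfolding read_body_def
        by (cases "0 < lam (Suc k)")
          (simp_all add: regs kregs el i, (rule I'; simp add: kregs fun_eq_iff)+)
      from run_block[OF this, of 9]
      show "run \<Lambda> (cells table_size) read_body s2 9 (\<lambda>s'. (\<exists>k\<le>n. I k s') \<and> \<mu> s' < \<mu> s2)"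
      proof (rule run_mono)
        fix s' assume "(I (Suc k) s' \<and> \<mu> s' < \<mu> s2) \<and> frame (writes read_body) s2 s'"
        then show "(\<exists>k\<le>n. I k s') \<and> \<mu> s' < \<mu> s2" using \<open>k < n\<close> by (meson Suc_leI)
      qed (simp_all add: read_body_def)
    qed simp
    then show ?thesis
    proof (rule run_mono)
      show "1 + \<mu> s1 * (1 + 9) \<le> 1 + n * 10" using s1 by (simp add: \<mu>_def I_def)
    next
      fix s2 assume s2: "(\<exists>k\<le>n. I k s2) \<and> \<not> holds (ILess 8 0) s2 \<and> frame (writes read_body) s1 s2"
      then have "E s2" using s1 unfolding E_def by (auto simp: frameD read_body_def)
      obtain k where k: "I k s2" "k \<le> n" using s2 by blast
      then have "k = n" using s2 \<open>E s2\<close> by (simp add: I_def E_def)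
      then show "E s2 \<and> I n s2" using k \<open>E s2\<close> by simp
    qed
  qed
  let ?b = "Basic (ILoad 9 2 7) ;; Basic (ROfInt 7 9) ;; Basic (RMul 7 7 5) ;;
      Basic (RAdd 4 7 5) ;; Basic (ICopy 10 7) ;; Basic (ICopy 15 6)"
  have 3: "run \<Lambda> (cells table_size) ?b s2 6
     (\<lambda>s'. env s' \<and> ireg s' 10 = int K \<and> ireg s' 15 = (int n + 1) * (int n + 1))"
    if s2: "E s2 \<and> I n s2" for s2
  proof -
    have "lam i = 0" if "\<not> i \<le> n" for i using that by (simp add: lam_def)
    then have a: "iarr s2 2 = (\<lambda>i. int (lam i))" using s2 by (auto simp: I_def)
    have lt: "K < table_size" by (rule lam_index) (use K_le in simp)
    have "ireg s2 7 = int K" using s2 K_le by (simp add: I_def)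
    then have "wp \<Lambda> (cells table_size) ?b
      (\<lambda>s'. env s' \<and> ireg s' 10 = int K \<and> ireg s' 15 = (int n + 1) * (int n + 1)) s2"
      using s2 lt by (simp add: env_def E_def I_def a B_def)
    from run_block[OF this, of 6] show ?thesis by (rule run_mono) auto
  qed
  have "run \<Lambda> (cells table_size) read_input (init_state n p) (7 + ((1 + n * 10) + 6))
     (\<lambda>s'. env s' \<and> ireg s' 10 = int K \<and> ireg s' 15 = (int n + 1) * (int n + 1))"
    unfolding read_input_def by (rule run_Seq[OF 1 run_Seq[OF 2 3]])
  then show ?thesis by (rule run_mono) auto
qed

lemma run_trace_init:
  assumes "env s" and s0: "ireg s 15 = int (idx (Suc K) 0 0)"
  shows "run \<Lambda> (cells table_size) trace_init s 7
     (\<lambda>s'. ireg s' 10 = 1 \<and> ireg s' 11 = int (lam 1) \<and> ireg s' 15 = int (idx K n 0) \<and>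
       ireg s' 16 = int n \<and> ireg s' 17 = int root_slots)" (is "run _ _ _ _ _ ?Q")
proof -
  have lt: "1 < table_size" by (rule lam_index) simp
  have i: "int (idx (Suc K) 0 0) = int (idx K n 0) + (int n + 1)"
    using int_idx_Suc[of K n] by (simp add: idx_wrap)
  have sh: "push_bit l 1 = (2::int) ^ l" for l by (simp add: push_bit_eq_mult)
  have rs: "int root_slots = (if int n < 2 ^ lam 1 then int n else 2 ^ lam 1)"
    by (auto simp: root_slots_def min_def of_nat_power[symmetric] simp del: of_nat_power)
  have "wp \<Lambda> (cells table_size) trace_init ?Q s"
    using \<open>env s\<close> lt unfolding trace_init_def rs
    by (cases "int n < 2 ^ lam 1") (simp_all add: env_def s0 i sh)
  from run_block[OF this, of 7] show ?thesis by (rule run_mono) (auto simp: trace_init_def)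
qed

lemma run_program:
  "run \<Lambda> (cells table_size) program (init_state n p)
     ((14 + n * 10) + ((1 + K * (16 + n * (10 + (n + 1) * (14 + n * 15)))) + (7 + (1 + K * (14 + n * 9)))))
     (\<lambda>s'. \<exists>X lev. canonical \<Lambda> n X lev (iarr s' 0) (iarr s' 1) \<and>
       (\<Sum>i=1..n. p i * real_of_int (iarr s' 0 i)) = val K n root_slots + B)"
  unfolding program_def
proof (rule run_Seq[OF run_frame[OF run_read_input]])
  fix s1 assume s1: "(env s1 \<and> ireg s1 10 = int K \<and> ireg s1 15 = (int n + 1) * (int n + 1)) \<and>
    frame (writes read_input) (init_state n p) s1"
  have z: "ireg s1 14 = 0" "rarr s1 1 k = 0" "ireg s1 26 = 0" "ireg s1 27 = 0" for k
    using conjunct2[OF s1] by (simp_all add: frameD init_state_def read_input_def read_body_def)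
  show "run \<Lambda> (cells table_size)
     (While (ILess 2 10) level_body ;; trace_init ;; While (ILess 2 16) trace_body) s1
     ((1 + K * (16 + n * (10 + (n + 1) * (14 + n * 15)))) + (7 + (1 + K * (14 + n * 9))))
     (\<lambda>s'. \<exists>X lev. canonical \<Lambda> n X lev (iarr s' 0) (iarr s' 1) \<and>
       (\<Sum>i=1..n. p i * real_of_int (iarr s' 0 i)) = val K n root_slots + B)"
  proof (rule run_Seq[OF run_frame[OF run_table]])
    fix s2 assume s2: "(env s2 \<and> ireg s2 10 = 0 \<and> ireg s2 15 = int (idx (Suc K) 0 0) \<and> filled s2 (Suc K) 1 0) \<and>
      frame (writes (While (ILess 2 10) level_body)) s1 s2"
    have z2: "ireg s2 26 = 0" "ireg s2 27 = 0"
      using conjunct2[OF s2] z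
      by (simp_all add: frameD choice_body_def cell_body_def row_body_def level_body_def)
    show "run \<Lambda> (cells table_size) (trace_init ;; While (ILess 2 16) trace_body) s2 (7 + (1 + K * (14 + n * 9)))
     (\<lambda>s'. \<exists>X lev. canonical \<Lambda> n X lev (iarr s' 0) (iarr s' 1) \<and>
       (\<Sum>i=1..n. p i * real_of_int (iarr s' 0 i)) = val K n root_slots + B)"
    proof (rule run_Seq[OF run_frame[OF run_trace_init]])
      fix s3 assume s3: "(ireg s3 10 = 1 \<and> ireg s3 11 = int (lam 1) \<and> ireg s3 15 = int (idx K n 0) \<and>
        ireg s3 16 = int n \<and> ireg s3 17 = int root_slots) \<and> frame (writes trace_init) s2 s3"
      have "env s3"
        by (rule env_frame[OF conjunct2[OF s3] conjunct1[OF conjunct1[OF s2]]])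
          (simp add: trace_init_def env_vars_def)
      moreover have "filled s3 (Suc K) 1 0"
        by (rule filled_cong[of s2]) (use s2 s3 in \<open>auto simp: frameD trace_init_def\<close>)
      moreover have "ireg s3 26 = 0" "ireg s3 27 = 0"
        using conjunct2[OF s3] z2 by (simp_all add: frameD trace_init_def)
      ultimately show "run \<Lambda> (cells table_size) (While (ILess 2 16) trace_body) s3 (1 + K * (14 + n * 9))
       (\<lambda>s'. \<exists>X lev. canonical \<Lambda> n X lev (iarr s' 0) (iarr s' 1) \<and>
         (\<Sum>i=1..n. p i * real_of_int (iarr s' 0 i)) = val K n root_slots + B)"
        by (intro run_trace) (use s3 in auto)
    qed (use s2 in auto)
  qed (use s1 z in auto)
qed

section \<open>Time and space in terms of \<open>K\<close> and \<open>n\<close>\<close>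

lemma run_time_bound:
  "(14 + n * 10) + ((1 + K * (16 + n * (10 + (n + 1) * (14 + n * 15)))) + (7 + (1 + K * (14 + n * 9))))
     \<le> 200 * (K * n ^ 3)"
proof -
  have n1: "1 \<le> n" "1 \<le> n ^ 2" "1 \<le> n ^ 3" "n \<le> n ^ 2" "n \<le> n ^ 3" "n ^ 2 \<le> n ^ 3"
    using n_pos by (auto intro: power_increasing[of 2 3 n] simp: power2_eq_square power3_eq_cube)
  have *: "n * (10 + (n + 1) * (14 + n * 15)) = 15 * n ^ 3 + 29 * n ^ 2 + 24 * n"
    by (simp add: algebra_simps power2_eq_square power3_eq_cube)
  \<comment> \<open>Powers of \<open>n\<close> are raised to \<open>n ^ 3\<close> and coefficients
    added: \<open>84 = 16 + 24 + 29 + 15\<close>. Together with \<open>23\<close> and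
    \<open>33\<close> below this stays under \<open>200\<close>.\<close>
  have a: "K * (16 + n * (10 + (n + 1) * (14 + n * 15))) \<le> K * (84 * n ^ 3)"
    unfolding * using n1 by (intro mult_le_mono2) linarith
  have b: "K * (14 + n * 9) \<le> K * (23 * n ^ 3)"
    using n1 by (intro mult_le_mono2) linarith
  have "n ^ 3 \<le> K * n ^ 3" using K_pos by simp
  moreover from this have "23 + n * 10 \<le> 33 * (K * n ^ 3)" using n1 by linarith
  ultimately show ?thesis using a b by linarith
qed

lemma space_bound:
  assumes "U \<subseteq> cells table_size"
  shows "space_used n U \<le> 200 * (K * n ^ 2)"
proof -
  have fin: "finite (cells N)" and card: "card (cells N) \<le> 40 + 6 * N" for N
  proof -
    have I: "{ICell A k | A k. A < 4 \<and> k < N} = (\<lambda>(A, k). ICell A k) ` ({..<4} \<times> {..<N})"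
      and R: "{RCell A k | A k. A < 2 \<and> k < N} = (\<lambda>(A, k). RCell A k) ` ({..<2} \<times> {..<N})"
      by auto
    show "finite (cells N)" unfolding cells_def I R by simp
    have "card (IReg ` {..<31}) \<le> 31" "card (RReg ` {..<9}) \<le> 9"
      using card_image_le[of "{..<31}" IReg] card_image_le[of "{..<9}" RReg] by auto
    moreover have "card {ICell A k | A k. A < 4 \<and> k < N} \<le> 4 * N" "card {RCell A k | A k. A < 2 \<and> k < N} \<le> 2 * N"
      unfolding I R by (rule order_trans[OF card_image_le]; simp)+
    ultimately show "card (cells N) \<le> 40 + 6 * N"
      unfolding cells_def
      using card_Un_le[of "IReg ` {..<31} \<union> RReg ` {..<9} \<union> {ICell A k | A k. A < 4 \<and> k < N}"
          "{RCell A k | A k. A < 2 \<and> k < N}"]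
        card_Un_le[of "IReg ` {..<31} \<union> RReg ` {..<9}" "{ICell A k | A k. A < 4 \<and> k < N}"]
        card_Un_le[of "IReg ` {..<31}" "RReg ` {..<9}"]
      by linarith
  qed
  have "n < table_size" by (rule lam_index) simp
  then have "input_cells n \<subseteq> cells table_size" by (auto simp: input_cells_def)
  then have W: "input_cells n \<union> U \<subseteq> cells table_size" using assms by simp
  then have "A < 4 \<and> m < table_size" if "ICell A m \<in> input_cells n \<union> U" for A m
    using that in_cells(3) by blast
  moreover have "A < 2 \<and> m < table_size" if "RCell A m \<in> input_cells n \<union> U" for A m
    using W that in_cells(4) by blast
  ultimately have "occupied (input_cells n \<union> U) \<subseteq> cells table_size"
    using W unfolding occupied_def by fastforce
  then have "space_used n U \<le> 40 + 6 * table_size"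
    unfolding space_used_def using card_mono[OF fin] card order_trans by blast
  \<comment> \<open>Uses \<open>K + 1 \<le> 2 * K\<close> and
    \<open>n + 1 \<le> 2 * n\<close>.\<close>
  also have "table_size \<le> ((2 * K) * (2 * n)) * (2 * n)"
    unfolding table_size_def using K_pos n_pos by (intro mult_le_mono) auto
  also have "\<dots> = 8 * (K * n ^ 2)" by (simp add: power2_eq_square)
  also have "1 \<le> K * n ^ 2" using K_pos n_pos by simp
  then have "40 + 6 * (8 * (K * n ^ 2)) \<le> 200 * (K * n ^ 2)" by linarith
  finally show ?thesis by simp
qed

lemma program_correct:
  "\<exists>t U s c. exec \<Lambda> program (init_state n p) t U s \<and> outputs_code n s c \<and>
     optimal_reserved_length_code n p \<Lambda> c \<and> t \<le> 200 * (K * n ^ 3) \<and> space_used n U \<le> 200 * (K * n ^ 2)"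
proof -
  obtain t U s X lev where ex: "exec \<Lambda> program (init_state n p) t U s" "t \<le> 200 * (K * n ^ 3)"
    "U \<subseteq> cells table_size" and can: "canonical \<Lambda> n X lev (iarr s 0) (iarr s 1)"
    and cost: "(\<Sum>i=1..n. p i * real_of_int (iarr s 0 i)) = val K n root_slots + B"
    using run_program run_time_bound unfolding run_def by (meson order_trans)
  define c where "c i = codeword (nat (iarr s 0 i)) (iarr s 1 i)" for i
  note cc = canonical_code[OF can, folded c_def]
  have "code_cost n p c = (\<Sum>i=1..n. p i * real_of_int (iarr s 0 i))"
    unfolding code_cost_def
  proof (rule sum.cong[OF refl])
    fix i assume "i \<in> {1..n}"
    then have "iarr s 0 i = int (length (c i))" using cc(2) by simp
    then show "p i * real (length (c i)) = p i * real_of_int (iarr s 0 i)" by simp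
  qed
  then have "optimal_reserved_length_code n p \<Lambda> c"
    using cost cc(1) optimal_of_val by simp
  moreover have "outputs_code n s c" unfolding outputs_code_def using cc(2) by simp
  ultimately show ?thesis using ex space_bound by blast
qed

end

theorem mainTheorem1:
  shows "\<exists>(P :: com) (C :: nat). \<forall>(n :: nat) (p :: nat \<Rightarrow> real) (\<Lambda> :: nat set).
    valid_instance n p \<Lambda> \<longrightarrow>
    (\<exists>t U s c.
       exec \<Lambda> P (init_state n p) t U s \<and>
       outputs_code n s c \<and>
       optimal_reserved_length_code n p \<Lambda> c \<and>
       (finite \<Lambda> \<longrightarrow> t \<le> C * (card \<Lambda> * n ^ 3) \<and> space_used n U \<le> C * (card \<Lambda> * n ^ 2)) \<and>
       t \<le> C * n ^ 4 \<and> space_used n U \<le> C * n ^ 3)"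
proof (rule exI[of _ program], rule exI[of _ 200], intro allI impI)
  fix n :: nat and p :: "nat \<Rightarrow> real" and \<Lambda> :: "nat set"
  assume "valid_instance n p \<Lambda>"
  then interpret reserved_instance n p \<Lambda> by unfold_locales
  obtain t U s c where r: "exec \<Lambda> program (init_state n p) t U s" "outputs_code n s c"
    "optimal_reserved_length_code n p \<Lambda> c" "t \<le> 200 * (K * n ^ 3)" "space_used n U \<le> 200 * (K * n ^ 2)"
    using program_correct by blast
  have "t \<le> 200 * (card \<Lambda> * n ^ 3)" "space_used n U \<le> 200 * (card \<Lambda> * n ^ 2)" if "finite \<Lambda>"
    using r(4,5) K_le_card[OF that]
    by (meson mult_le_mono1 mult_le_mono2 order_trans)+
  moreover have "K * n ^ 3 \<le> n ^ 4" "K * n ^ 2 \<le> n ^ 3"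
    using K_le by (simp_all add: power_numeral_reduce)
  then have "t \<le> 200 * n ^ 4" "space_used n U \<le> 200 * n ^ 3"
    using r(4,5) by linarith+
  ultimately show "\<exists>t U s c.
       exec \<Lambda> program (init_state n p) t U s \<and>
       outputs_code n s c \<and>
       optimal_reserved_length_code n p \<Lambda> c \<and>
       (finite \<Lambda> \<longrightarrow> t \<le> 200 * (card \<Lambda> * n ^ 3) \<and> space_used n U \<le> 200 * (card \<Lambda> * n ^ 2)) \<and>
       t \<le> 200 * n ^ 4 \<and> space_used n U \<le> 200 * n ^ 3"
    using r(1-3) by blast
qed

end
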